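(* For $k\ge 0$ let $a_0=0$ and $a_k=\sum_{i=0}^{k}4^i$ for $k>0$. Let $k\ge1$, $n\in\{a_{k-1}+1,\dots,a_k\}$ and $r\in\mathbb{N}$. Then \[ HH(n,r)\subset TT(n,r^k) \] when the leaves of the almost perfect binary tree are labelled in the natural left-to-right order (the same order as the leaves of the train track tree). On the other hand, for any labelling (permutation) of the leaves of the almost perfect binary tree, \[ HH(n,r)\not\subset TT(n,r^k-1). \]
   Context: Fix finite-dimensional complex vector spaces $V_1,\dots,V_n$. For an (unrooted) tree $\mathcal{T}$ whose leaves are labelled $1,\dots,n$ and $s\in\mathbb{N}$, $\mathrm{TNS}(\mathcal{T},s)$ is the set of $t\in V_1\otimes\dots\otimes V_n$ such that for every edge $e$, with $\overleftarrow{e}$ the set of leaves on one side of $e$, $\dim((\bigotimes_{l\in\overleftarrow{e}}V_l)^*\lrcorner\, t)\le s$, where $(\bigotimes_{l\in B}V_l)^*\lrcorner\, t$ denotes the image of the contraction map $(\bigotimes_{l\in B}V_l)^*\to\bigotimes_{l\notin B}V_l$ induced by $t$. The train track tree with $n$ leaves is the binary tree consisting of a path of inner vertices $v_2,\dots,v_{n-1}$ with leaves $1,2$ attached to $v_2$, leaf $i$ attached to $v_i$ for $2<i<n-1$, and leaves $n-1,n$ attached to $v_{n-1}$ (so its edge flattenings are the sets $\{1,\dots,j\}$); $TT(n,s)=\mathrm{TNS}(\text{train track tree},s)$. An almost perfect binary tree with $n$ leaves is a rooted binary tree differing from a perfect binary tree only by missing the last leaves of the last row (all levels but the deepest full, every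 non-leaf vertex with two children, deepest vertices leftmost), regarded as unrooted by removing the root and merging its two edges; its natural order labels leaves left to right in the standard planar drawing. $HH(n,s)=\mathrm{TNS}(\text{almost perfect binary tree with } n\text{ leaves},s)$.
   Formalization: The non-inclusion is proved for n ≥ 2, r ≥ 1 and dim V_l ≥ r for every leaf l; it fails as stated for small spaces (all V_l one-dimensional, n = 2, r = 2) and for n = 1, and r^k − 1 is negative for r = 0. *)

theory Defs
  imports Complex_Main "HOL-Library.FuncSet" "HOL-Library.Function_Algebras"
    "HOL-Library.Discrete_Functions" "HOL-Combinatorics.Permutations"
begin

section \<open>Tensors\<close>

text \<open>
  We take \<open>V\<^sub>l = \<complex>\<^bsup>d l\<^esup>\<close>. An element of the tensor product of the \<open>V\<^sub>l\<close>, \<open>l \<in> B\<close>, is given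
  by its coordinates, indexed by the multi-indices \<open>x\<close> with \<open>x l < d l\<close> for \<open>l \<in> B\<close>, and is
  extended by \<open>0\<close> to all other arguments.
\<close>

type_synonym tensor = "(nat \<Rightarrow> nat) \<Rightarrow> complex"

definition multi_indices :: "(nat \<Rightarrow> nat) \<Rightarrow> nat set \<Rightarrow> (nat \<Rightarrow> nat) set" where
  "multi_indices d B = (\<Pi>\<^sub>E l\<in>B. {..<d l})"

definition tensors :: "(nat \<Rightarrow> nat) \<Rightarrow> nat set \<Rightarrow> tensor set" where
  "tensors d B = {t. \<forall>x. x \<notin> multi_indices d B \<longrightarrow> t x = 0}"

global_interpretation tensor_space: vector_space "\<lambda>(c::complex) (t::tensor) x. c * t x"
  by unfold_locales (auto simp: fun_eq_iff algebra_simps)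

text \<open>
  A linear form on the tensor product over \<open>B\<close> is given by its coordinates \<open>\<phi> \<in> tensors d B\<close>
  in the dual basis. A multi-index over \<open>A\<close> is composed of its parts \<open>x\<close> over \<open>B\<close> and
  \<open>y\<close> over \<open>A - B\<close>.
\<close>

definition contraction ::
    "(nat \<Rightarrow> nat) \<Rightarrow> nat set \<Rightarrow> nat set \<Rightarrow> tensor \<Rightarrow> tensor \<Rightarrow> tensor" where
  "contraction d A B t \<phi> = (\<lambda>y.
     if y \<in> multi_indices d (A - B)
     then \<Sum>x\<in>multi_indices d B. \<phi> x * t (override_on y x B)
     else 0)"

definition flattening_rank :: "(nat \<Rightarrow> nat) \<Rightarrow> nat set \<Rightarrow> nat set \<Rightarrow> tensor \<Rightarrow> nat" where
  "flattening_rank d A B t = tensor_space.dim (contraction d A B t ` tensors d B)"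


section \<open>Tensor network states of leaf-labelled trees\<close>

text \<open>
  A tree is given by its set of edges, an edge being the set of its two endpoints; its leaves
  are labelled \<open>1, \<dots>, n\<close> by a function \<open>leaf\<close>.
\<close>

definition leaves_on_side :: "nat \<Rightarrow> 'v set set \<Rightarrow> (nat \<Rightarrow> 'v) \<Rightarrow> 'v set \<Rightarrow> 'v \<Rightarrow> nat set" where
  "leaves_on_side n E leaf e u =
     {l \<in> {1..n}. (u, leaf l) \<in> {(v, w). {v, w} \<in> E - {e}}\<^sup>*}"

text \<open>Both sides of an edge give the same rank; we impose the bound for both.\<close>

definition TNS :: "(nat \<Rightarrow> nat) \<Rightarrow> nat \<Rightarrow> 'v set set \<Rightarrow> (nat \<Rightarrow> 'v) \<Rightarrow> nat \<Rightarrow> tensor set" where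
  "TNS d n E leaf s =
     {t \<in> tensors d {1..n}.
        \<forall>e\<in>E. \<forall>u\<in>e. flattening_rank d {1..n} (leaves_on_side n E leaf e u) t \<le> s}"


section \<open>The train track tree\<close>

datatype tt_vertex = Leaf nat | Inner nat

text \<open>
  For \<open>n = 2\<close> there are no inner vertices and the tree is a single edge; for \<open>n = 1\<close> it has no edge.
\<close>

definition tt_edges :: "nat \<Rightarrow> tt_vertex set set" where
  "tt_edges n =
     (if n < 2 then {}
      else if n = 2 then {{Leaf 1, Leaf 2}}
      else {{Inner i, Inner (i + 1)} | i. 2 \<le> i \<and> i + 1 < n}
         \<union> {{Leaf i, Inner i} | i. 2 \<le> i \<and> i < n}
         \<union> {{Leaf 1, Inner 2}, {Leaf n, Inner (n - 1)}})"

definition TT :: "(nat \<Rightarrow> nat) \<Rightarrow> nat \<Rightarrow> nat \<Rightarrow> tensor set" where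
  "TT d n s = TNS d n (tt_edges n) Leaf s"


section \<open>The almost perfect binary tree\<close>

text \<open>
  The vertex \<open>(j, i)\<close> is the \<open>i\<close>-th vertex from the left, counted from \<open>0\<close>, at depth \<open>j\<close>; its
  children, if any, are \<open>(j + 1, 2 * i)\<close> and \<open>(j + 1, 2 * i + 1)\<close>. Writing \<open>n = 2 ^ h + m\<close> with
  \<open>m < 2 ^ h\<close>, the rows of depth at most \<open>h\<close> are full, and precisely the \<open>m\<close> leftmost vertices of
  row \<open>h\<close> have children.
\<close>

definition full_depth :: "nat \<Rightarrow> nat" where
  "full_depth n = floor_log n"

definition excess :: "nat \<Rightarrow> nat" where
  "excess n = n - 2 ^ full_depth n"

definition apb_inner :: "nat \<Rightarrow> (nat \<times> nat) set" where
  "apb_inner n =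
     {(j, i). j < full_depth n \<and> i < 2 ^ j \<or> j = full_depth n \<and> i < excess n}"

definition apb_rooted_edges :: "nat \<Rightarrow> (nat \<times> nat) set set" where
  "apb_rooted_edges n =
     (\<Union>(j, i)\<in>apb_inner n. {{(j, i), (j + 1, 2 * i)}, {(j, i), (j + 1, 2 * i + 1)}})"

text \<open>Removal of the root \<open>\<rho>\<close>, with its two edges merged into one.\<close>

definition unroot :: "'v \<Rightarrow> 'v set set \<Rightarrow> 'v set set" where
  "unroot \<rho> E = {e \<in> E. \<rho> \<notin> e} \<union> {{v, w} | v w. v \<noteq> w \<and> {\<rho>, v} \<in> E \<and> {\<rho>, w} \<in> E}"

definition apb_edges :: "nat \<Rightarrow> (nat \<times> nat) set set" where
  "apb_edges n = unroot (0, 0) (apb_rooted_edges n)"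

text \<open>
  The \<open>l\<close>-th leaf from the left, \<open>1 \<le> l \<le> n\<close>: first the \<open>2 * m\<close> leaves of row \<open>h + 1\<close>, then
  the vertices \<open>m, \<dots>, 2 ^ h - 1\<close> of row \<open>h\<close>.
\<close>

definition natural_leaf :: "nat \<Rightarrow> nat \<Rightarrow> nat \<times> nat" where
  "natural_leaf n l =
     (if l \<le> 2 * excess n then (full_depth n + 1, l - 1)
      else (full_depth n, l - 1 - excess n))"

text \<open>The label \<open>l\<close> is put on the \<open>\<pi> l\<close>-th leaf from the left.\<close>

definition HH_labelled ::
    "(nat \<Rightarrow> nat) \<Rightarrow> nat \<Rightarrow> (nat \<Rightarrow> nat) \<Rightarrow> nat \<Rightarrow> tensor set" where
  "HH_labelled d n \<pi> s = TNS d n (apb_edges n) (\<lambda>l. natural_leaf n (\<pi> l)) s"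

definition HH :: "(nat \<Rightarrow> nat) \<Rightarrow> nat \<Rightarrow> nat \<Rightarrow> tensor set" where
  "HH d n s = HH_labelled d n id s"


section \<open>The threshold sequence\<close>

definition threshold :: "nat \<Rightarrow> nat" where
  "threshold k = (if k = 0 then 0 else \<Sum>i=0..k. 4 ^ i)"

end

theory Submission
  imports Defs
begin

text \<open>
  If a set of leaves is cut off by \<open>c\<close> edges of the tree, then the flattening rank of a state in
  \<open>TNS\<close> with bond dimension \<open>r\<close> is at most \<open>r ^ c\<close> there, since flattening ranks are invariant
  under complements and submultiplicative under disjoint unions. To cut off a prefix of the
  leaves of the almost perfect binary tree, climb to the root along the binary digits of the
  boundary position: an additional edge is needed only when the direction changes, hence at most
  once for every two levels, and the bound \<open>n \<le> threshold k\<close> is exactly what excludes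
  \<open>k + 1\<close> edges.

  Conversely, products of \<open>r\<close>-dimensional Bell pairs along edge-disjoint paths between leaves
  lie in \<open>TNS\<close>, and \<open>k\<close> such pairs separated by \<open>{1..j}\<close> give the rank \<open>r ^ k\<close> there. They
  exist for every labelling: if three disjoint subtrees each contain \<open>k\<close> such pairs,
  separated by the prefixes of lengths \<open>j\<^sub>1 \<le> j\<^sub>2 \<le> j\<^sub>3\<close>, then the second subtree's pairs
  together with a pair joining the first and the third subtree are \<open>k + 1\<close> pairs separated by the
  prefix of length \<open>j\<^sub>2\<close>. In the almost perfect tree two grandchildren of the root of a subtree and
  its right child provide three such subtrees, whence the factor \<open>4\<close> in the thresholds.
\<close>

section \<open>Flattening ranks\<close>

text \<open>For \<open>x\<close> in \<open>multi_indices d B\<close> this is the contraction with a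
  dual basis vector, a row of the flattening matrix; these rows span the image of the
  contraction.\<close>

definition slice :: "(nat \<Rightarrow> nat) \<Rightarrow> nat set \<Rightarrow> nat set \<Rightarrow> tensor \<Rightarrow> (nat \<Rightarrow> nat) \<Rightarrow> tensor" where
  "slice d A B t x = (\<lambda>y. if y \<in> multi_indices d (A - B) then t (override_on y x B) else 0)"

lemma finite_multi_indices: "finite B \<Longrightarrow> finite (multi_indices d B)"
  unfolding multi_indices_def by (rule finite_PiE) auto

lemma restrict_multi_indices:
  "x \<in> multi_indices d A \<Longrightarrow> B \<subseteq> A \<Longrightarrow> restrict x B \<in> multi_indices d B"
  unfolding multi_indices_def by (auto simp: PiE_iff)

lemma override_on_multi_indices:
  "\<lbrakk>y \<in> multi_indices d (A - B); x \<in> multi_indices d B; B \<subseteq> A\<rbrakk>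
    \<Longrightarrow> override_on y x B \<in> multi_indices d A"
  unfolding multi_indices_def by (auto simp: PiE_iff override_on_def extensional_def)

lemma override_on_restrict_complement:
  "x \<in> multi_indices d A \<Longrightarrow> C \<subseteq> B \<Longrightarrow> B \<subseteq> A \<Longrightarrow>
    override_on (restrict x (A - C)) y B = override_on x y B"
  unfolding multi_indices_def by (auto simp: PiE_iff override_on_def extensional_def fun_eq_iff)

lemma restrict_override_on:
  assumes "x \<in> multi_indices d B" "y \<in> multi_indices d (A - B)" "B \<subseteq> A"
  shows "restrict (override_on y x B) B = x" "restrict (override_on y x B) (A - B) = y"
  using assms unfolding multi_indices_def
  by (auto simp: PiE_iff override_on_def extensional_def fun_eq_iff)

lemma sum_tensor_apply: "(\<Sum>i\<in>I. F i :: tensor) y = (\<Sum>i\<in>I. F i y)"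
  by (induction I rule: infinite_finite_induct) auto

lemma contraction_eq_sum_slices:
  "contraction d A B t \<phi> = (\<Sum>x\<in>multi_indices d B. (\<lambda>y. \<phi> x * slice d A B t x y))"
  by (auto simp: fun_eq_iff contraction_def slice_def sum_tensor_apply)

lemma slice_in_contraction_image:
  assumes "finite B" "x \<in> multi_indices d B"
  shows "slice d A B t x \<in> contraction d A B t ` tensors d B"
proof
  show "(\<lambda>z. if z = x then 1 else 0) \<in> tensors d B"
    using assms by (auto simp: tensors_def)
  show "slice d A B t x = contraction d A B t (\<lambda>z. if z = x then 1 else 0)"
    using assms finite_multi_indices[OF assms(1), of d]
    by (intro ext) (simp add: slice_def contraction_def if_distrib[of "\<lambda>c. c * _"] cong: if_cong)
qed

text \<open>The ambient space is infinite-dimensional and \<open>card\<close> of an infinite set is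
  0, so finiteness of the basis matters. It holds because finitely many slices span the
  image.\<close>

lemma flattening_rank_basis:
  assumes "finite B"
  obtains S where "finite S" "card S = flattening_rank d A B t"
    "S \<subseteq> contraction d A B t ` tensors d B"
    "contraction d A B t ` tensors d B \<subseteq> tensor_space.span S"
proof -
  let ?V = "contraction d A B t ` tensors d B"
  obtain S where S: "S \<subseteq> ?V" "tensor_space.independent S" "?V \<subseteq> tensor_space.span S"
    "card S = tensor_space.dim ?V"
    by (rule tensor_space.basis_exists)
  let ?W = "slice d A B t ` multi_indices d B"
  have "?V \<subseteq> tensor_space.span ?W"
    unfolding contraction_eq_sum_slices
    by (intro image_subsetI tensor_space.span_sum)
      (intro tensor_space.span_scale tensor_space.span_base imageI)
  hence "finite S"
    using tensor_space.independent_span_bound[of ?W S] S(1,2) finite_multi_indices[OF assms]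
    by blast
  thus thesis using S by (intro that[of S]) (auto simp: flattening_rank_def)
qed

text \<open>Every slice is a combination of the \<open>g i\<close>, cut off to 0 outside the
  multi-indices as slices are.\<close>

lemma flattening_rank_le_card:
  assumes "finite I" "B \<subseteq> A"
    and t: "\<And>x. x \<in> multi_indices d A \<Longrightarrow>
      t x = (\<Sum>i\<in>I. f i (restrict x B) * g i (restrict x (A - B)))"
  shows "flattening_rank d A B t \<le> card I"
proof -
  define G where "G i = (\<lambda>y. if y \<in> multi_indices d (A - B) then g i y else 0)" for i
  have "contraction d A B t \<phi> \<in> tensor_space.span (G ` I)" for \<phi>
  proof -
    have "slice d A B t x \<in> tensor_space.span (G ` I)" if x: "x \<in> multi_indices d B" for x
    proof -
      have "slice d A B t x = (\<Sum>i\<in>I. (\<lambda>y. f i x * G i y))"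
        using x assms(2)
        by (auto simp: fun_eq_iff slice_def sum_tensor_apply G_def t override_on_multi_indices
            restrict_override_on)
      moreover have "\<dots> \<in> tensor_space.span (G ` I)"
        by (rule tensor_space.span_sum)
          (intro tensor_space.span_scale tensor_space.span_base imageI)
      ultimately show ?thesis by simp
    qed
    thus ?thesis
      unfolding contraction_eq_sum_slices
      by (intro tensor_space.span_sum tensor_space.span_scale)
  qed
  hence "flattening_rank d A B t \<le> card (G ` I)"
    unfolding flattening_rank_def using assms(1) by (intro tensor_space.dim_le_card) auto
  thus ?thesis using card_image_le[OF assms(1), of G] by linarith
qed

text \<open>
  The slices of \<open>t\<close> are combinations of basis elements of the image of the contraction, and these
  are themselves contractions of \<open>t\<close>. So \<open>t\<close> is fixed by an operator of rank \<open>card S\<close> that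
  acts on the factors in \<open>B\<close> only.
\<close>

lemma flattening_rank_projection:
  assumes "finite A" "B \<subseteq> A"
  obtains S :: "tensor set" and f \<phi> where "finite S" "card S = flattening_rank d A B t"
    "\<forall>x\<in>multi_indices d A.
      t x = (\<Sum>i\<in>S. f i (restrict x B) *
              (\<Sum>y\<in>multi_indices d B. \<phi> i y * t (override_on x y B)))"
proof -
  have finB: "finite B" using assms finite_subset by blast
  obtain S where S: "finite S" "card S = flattening_rank d A B t"
    "S \<subseteq> contraction d A B t ` tensors d B"
    "contraction d A B t ` tensors d B \<subseteq> tensor_space.span S"
    by (rule flattening_rank_basis[OF finB])
  have "\<forall>s\<in>S. \<exists>\<phi>. s = contraction d A B t \<phi>" using S(3) by auto
  then obtain \<phi> where \<phi>: "\<And>s. s \<in> S \<Longrightarrow> s = contraction d A B t (\<phi> s)" by metis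
  have "\<exists>u. slice d A B t x = (\<Sum>s\<in>S. (\<lambda>y. u s * s y))" if "x \<in> multi_indices d B" for x
  proof -
    have "slice d A B t x \<in> tensor_space.span S"
      using S(4) slice_in_contraction_image[OF finB that] by blast
    thus ?thesis unfolding tensor_space.span_finite[OF S(1)] by auto
  qed
  hence "\<forall>x\<in>multi_indices d B. \<exists>u. slice d A B t x = (\<Sum>s\<in>S. (\<lambda>y. u s * s y))" by blast
  from bchoice[OF this] obtain u where
    u: "\<And>x. x \<in> multi_indices d B \<Longrightarrow> slice d A B t x = (\<Sum>s\<in>S. (\<lambda>y. u x s * s y))"
    by blast
  show thesis
  proof (rule that[OF S(1,2), of "\<lambda>s x. u x s" \<phi>], rule ballI)
    fix x assume x: "x \<in> multi_indices d A"
    let ?x = "restrict x B" and ?y = "restrict x (A - B)"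
    have x': "?x \<in> multi_indices d B" and y': "?y \<in> multi_indices d (A - B)"
      using restrict_multi_indices[OF x] assms by auto
    have "override_on x ?x B = x" by (auto simp: override_on_def fun_eq_iff)
    hence "t x = slice d A B t ?x ?y"
      using y' assms x by (simp add: slice_def override_on_restrict_complement)
    also have "\<dots> = (\<Sum>s\<in>S. u ?x s * s ?y)"
      by (simp add: u[OF x'] sum_tensor_apply)
    also have "\<dots> = (\<Sum>s\<in>S. u ?x s * contraction d A B t (\<phi> s) ?y)"
      using \<phi> by (intro sum.cong refl) metis
    also have "\<dots> = (\<Sum>s\<in>S. u ?x s *
              (\<Sum>y\<in>multi_indices d B. \<phi> s y * t (override_on x y B)))"
      using y' x assms by (simp add: contraction_def override_on_restrict_complement)
    finally show "t x = \<dots>" .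
  qed
qed

text \<open>The projection formula writes \<open>t\<close> as a sum of products of a function on
  \<open>B\<close> and one on \<open>A - B\<close>; exchanging the two factors bounds the rank at
  the complement.\<close>

lemma flattening_rank_complement_le:
  assumes "finite A" "B \<subseteq> A"
  shows "flattening_rank d A (A - B) t \<le> flattening_rank d A B t"
proof -
  obtain S f \<phi> where S: "finite S" "card S = flattening_rank d A B t"
    and t: "\<forall>x\<in>multi_indices d A.
      t x = (\<Sum>i\<in>(S::tensor set). f i (restrict x B) *
              (\<Sum>y\<in>multi_indices d B. \<phi> i y * t (override_on x y B)))"
    by (rule flattening_rank_projection[OF assms, where d = d and t = t])
  have compl: "A - (A - B) = B" using assms(2) by blast
  have "flattening_rank d A (A - B) t \<le> card S"
  proof (rule flattening_rank_le_card[OF S(1), of _ _ _ _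
        "\<lambda>i w. \<Sum>y\<in>multi_indices d B. \<phi> i y * t (override_on w y B)" f])
    fix x assume x: "x \<in> multi_indices d A"
    show "t x = (\<Sum>i\<in>S. (\<Sum>y\<in>multi_indices d B. \<phi> i y *
      t (override_on (restrict x (A - B)) y B)) * f i (restrict x (A - (A - B))))"
      unfolding compl override_on_restrict_complement[OF x order_refl assms(2)]
      by (subst bspec[OF t x]) (simp only: mult.commute)
  qed auto
  thus ?thesis using S(2) by simp
qed

lemma flattening_rank_complement:
  assumes "finite A" "B \<subseteq> A"
  shows "flattening_rank d A (A - B) t = flattening_rank d A B t"
proof -
  have "A - (A - B) = B" using assms(2) by blast
  thus ?thesis
    using flattening_rank_complement_le[OF assms, of d t]
      flattening_rank_complement_le[OF assms(1), of "A - B" d t] by simp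
qed

lemma sum_mult_sum_swap:
  fixes c :: "'c :: comm_semiring_0"
  shows "c * (\<Sum>y\<in>Y. u y * (\<Sum>j\<in>J. v j * w j y)) = (\<Sum>j\<in>J. c * v j * (\<Sum>y\<in>Y. u y * w j y))"
proof -
  have "c * (\<Sum>y\<in>Y. u y * (\<Sum>j\<in>J. v j * w j y)) = (\<Sum>y\<in>Y. \<Sum>j\<in>J. c * v j * (u y * w j y))"
    unfolding sum_distrib_left by (intro sum.cong refl) (simp only: mult_ac)
  also have "\<dots> = (\<Sum>j\<in>J. \<Sum>y\<in>Y. c * v j * (u y * w j y))" by (rule sum.swap)
  finally show ?thesis by (simp only: sum_distrib_left)
qed

text \<open>Apply the projection on \<open>B\<close> and then, inside it, the projection on
  \<open>C\<close>. As \<open>B\<close> and \<open>C\<close> are disjoint, overwriting on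
  \<open>B\<close> leaves the \<open>C\<close>-part alone, so the result is a sum of products
  indexed by \<open>S \<times> T\<close>.\<close>

lemma flattening_rank_Un:
  assumes "finite A" "B \<subseteq> A" "C \<subseteq> A" "B \<inter> C = {}"
  shows "flattening_rank d A (B \<union> C) t \<le> flattening_rank d A B t * flattening_rank d A C t"
proof -
  obtain S f \<phi> where S: "finite S" "card S = flattening_rank d A B t"
    and tS: "\<forall>x\<in>multi_indices d A.
      t x = (\<Sum>i\<in>(S::tensor set). f i (restrict x B) *
              (\<Sum>y\<in>multi_indices d B. \<phi> i y * t (override_on x y B)))"
    by (rule flattening_rank_projection[OF assms(1,2), where d = d and t = t])
  obtain T g \<psi> where T: "finite T" "card T = flattening_rank d A C t"
    and tT: "\<forall>x\<in>multi_indices d A.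
      t x = (\<Sum>i\<in>(T::tensor set). g i (restrict x C) *
              (\<Sum>y\<in>multi_indices d C. \<psi> i y * t (override_on x y C)))"
    by (rule flattening_rank_projection[OF assms(1,3), where d = d and t = t])
  define F where "F = (\<lambda>(i, j) w. f i (restrict w B) * g j (restrict w C))"
  define G where "G = (\<lambda>(i, j) w. \<Sum>y\<in>multi_indices d B. \<phi> i y *
    (\<Sum>z\<in>multi_indices d C. \<psi> j z * t (override_on (override_on w y B) z C)))"
  have "flattening_rank d A (B \<union> C) t \<le> card (S \<times> T)"
  proof (rule flattening_rank_le_card[of _ _ _ _ _ F G])
    fix x assume x: "x \<in> multi_indices d A"
    have res: "restrict (restrict x (B \<union> C)) B = restrict x B"
      "restrict (restrict x (B \<union> C)) C = restrict x C"
      by (auto simp: restrict_def fun_eq_iff)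
    have ov: "override_on (override_on (restrict x (A - (B \<union> C))) y B) z C
      = override_on (override_on x y B) z C" for y z
      using x by (auto simp: multi_indices_def PiE_iff override_on_def extensional_def fun_eq_iff)
    have "t (override_on x y B) = (\<Sum>j\<in>T. g j (restrict x C) *
      (\<Sum>z\<in>multi_indices d C. \<psi> j z * t (override_on (override_on x y B) z C)))"
      if "y \<in> multi_indices d B" for y
    proof -
      have "override_on x y B \<in> multi_indices d A"
        using x that assms(2)
        by (auto simp: multi_indices_def PiE_iff override_on_def extensional_def)
      moreover have "restrict (override_on x y B) C = restrict x C"
        using assms(4) by (auto simp: restrict_def override_on_def fun_eq_iff)
      ultimately show ?thesis by (subst bspec[OF tT]) simp_all
    qed
    hence "t x = (\<Sum>i\<in>S. f i (restrict x B) * (\<Sum>y\<in>multi_indices d B. \<phi> i y *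
      (\<Sum>j\<in>T. g j (restrict x C) *
      (\<Sum>z\<in>multi_indices d C. \<psi> j z * t (override_on (override_on x y B) z C)))))"
      by (subst bspec[OF tS x]) simp
    also have "\<dots> = (\<Sum>i\<in>S. \<Sum>j\<in>T. f i (restrict x B) * g j (restrict x C) *
      (\<Sum>y\<in>multi_indices d B. \<phi> i y *
      (\<Sum>z\<in>multi_indices d C. \<psi> j z * t (override_on (override_on x y B) z C))))"
      by (simp only: sum_mult_sum_swap)
    also have "\<dots> = (\<Sum>p\<in>S \<times> T. F p (restrict x (B \<union> C)) * G p (restrict x (A - (B \<union> C))))"
      by (simp add: F_def G_def res ov sum.cartesian_product case_prod_unfold)
    finally show "t x = \<dots>" .
  qed (use assms S T in auto)
  thus ?thesis using S T by (simp add: card_cartesian_product)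
qed

text \<open>The complement of \<open>B - C\<close> is the disjoint union of \<open>A - B\<close> and
  \<open>C\<close>.\<close>

lemma flattening_rank_Diff:
  assumes "finite A" "B \<subseteq> A" "C \<subseteq> B"
  shows "flattening_rank d A (B - C) t \<le> flattening_rank d A B t * flattening_rank d A C t"
proof -
  have eq: "A - (B - C) = (A - B) \<union> C" using assms by blast
  have "flattening_rank d A (B - C) t = flattening_rank d A ((A - B) \<union> C) t"
    unfolding eq[symmetric] using assms by (intro flattening_rank_complement[symmetric]) auto
  also have "\<dots> \<le> flattening_rank d A (A - B) t * flattening_rank d A C t"
    using assms by (intro flattening_rank_Un) auto
  finally show ?thesis using assms by (simp add: flattening_rank_complement)
qed

text \<open>Only an inequality, since the rank is 0 for the zero tensor.\<close>

lemma flattening_rank_empty: "flattening_rank d A {} t \<le> 1"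
proof -
  have "flattening_rank d A {} t \<le> card {()}"
    by (rule flattening_rank_le_card[of _ _ _ _ _ "\<lambda>_ _. 1" "\<lambda>_. t"])
      (auto simp: multi_indices_def)
  thus ?thesis by simp
qed

text \<open>The rows \<open>X i\<close> and columns \<open>Y j\<close> form an identity submatrix of
  the flattening, so the slices at the \<open>X i\<close> are independent.\<close>

lemma card_le_flattening_rank:
  assumes "finite B" "finite I"
    and X: "\<And>i. i \<in> I \<Longrightarrow> X i \<in> multi_indices d B"
    and Y: "\<And>i. i \<in> I \<Longrightarrow> Y i \<in> multi_indices d (A - B)"
    and t: "\<And>i j. i \<in> I \<Longrightarrow> j \<in> I \<Longrightarrow> t (override_on (Y j) (X i) B) = (if i = j then 1 else 0)"
  shows "card I \<le> flattening_rank d A B t"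
proof -
  let ?v = "\<lambda>i. slice d A B t (X i)"
  have v: "?v i (Y j) = (if i = j then 1 else 0)" if "i \<in> I" "j \<in> I" for i j
    using that t Y by (simp add: slice_def)
  have inj: "inj_on ?v I"
    by (rule inj_onI) (metis v zero_neq_one)
  have "tensor_space.independent (?v ` I)"
  proof (rule tensor_space.independent_if_scalars_zero)
    fix u w assume 0: "(\<Sum>w\<in>?v ` I. (\<lambda>x. u w * w x)) = 0" and "w \<in> ?v ` I"
    then obtain j where j: "j \<in> I" "w = ?v j" by blast
    have "0 = (\<Sum>w\<in>?v ` I. (\<lambda>x. u w * w x)) (Y j)" by (simp add: 0)
    also have "\<dots> = (\<Sum>i\<in>I. u (?v i) * ?v i (Y j))"
      by (simp add: sum_tensor_apply sum.reindex[OF inj])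
    also have "\<dots> = (\<Sum>i\<in>I. if i = j then u (?v i) else 0)"
      using j(1) by (intro sum.cong refl) (simp add: v)
    also have "\<dots> = u w"
      using j assms(2) by simp
    finally show "u w = 0" by simp
  qed (use assms in auto)
  moreover obtain S where S: "finite S" "card S = flattening_rank d A B t"
    "contraction d A B t ` tensors d B \<subseteq> tensor_space.span S"
    by (rule flattening_rank_basis[OF assms(1)])
  moreover have "?v ` I \<subseteq> contraction d A B t ` tensors d B"
    using X slice_in_contraction_image[OF assms(1)] by blast
  ultimately have "card (?v ` I) \<le> card S"
    using tensor_space.independent_span_bound[of S "?v ` I"] by blast
  thus ?thesis using S by (simp add: card_image[OF inj])
qed

section \<open>Sides of the edges\<close>

abbreviation adjacency :: "'v set set \<Rightarrow> ('v \<times> 'v) set" where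
  "adjacency E \<equiv> {(v, w). {v, w} \<in> E}"

lemma adjacency_rtrancl_sym: "(v, w) \<in> (adjacency E)\<^sup>* \<Longrightarrow> (w, v) \<in> (adjacency E)\<^sup>*"
proof -
  assume "(v, w) \<in> (adjacency E)\<^sup>*"
  moreover have "sym (adjacency E)" by (auto simp: sym_def insert_commute)
  ultimately show ?thesis using symD[OF sym_rtrancl] by fast
qed

text \<open>Follow the path: each time it uses the removed edge it arrives at \<open>u\<close> or
  \<open>w\<close>, from where the search restarts.\<close>

lemma reachable_without_edge:
  assumes "(u, x) \<in> (adjacency E)\<^sup>*"
  shows "(u, x) \<in> (adjacency (E - {{u, w}}))\<^sup>* \<or> (w, x) \<in> (adjacency (E - {{u, w}}))\<^sup>*"
  using assms
proof (induction rule: rtrancl_induct)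
  case (step y z)
  show ?case
  proof (cases "{y, z} = {u, w}")
    case True
    thus ?thesis by (auto simp: doubleton_eq_iff)
  next
    case False
    hence "(y, z) \<in> adjacency (E - {{u, w}})" using step.hyps by auto
    thus ?thesis using step.IH by (meson rtrancl.rtrancl_into_rtrancl)
  qed
qed auto

lemma reachable_in_closed:
  assumes "(u, x) \<in> (adjacency E)\<^sup>*" "\<And>v w. {v, w} \<in> E \<Longrightarrow> v \<in> C \<longleftrightarrow> w \<in> C"
  shows "u \<in> C \<longleftrightarrow> x \<in> C"
  using assms(1) by (induction rule: rtrancl_induct) (use assms(2) in auto)

text \<open>Replaces any general theory of trees: a set \<open>C\<close> that no other edge leaves
  shows that the two sides are disjoint, and connectedness shows that together they contain all
  leaves.\<close>

lemma leaves_on_side_eq: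
  assumes closed: "\<And>v x. {v, x} \<in> E \<Longrightarrow> {v, x} \<noteq> {u, w} \<Longrightarrow> v \<in> C \<longleftrightarrow> x \<in> C"
    and uw: "u \<in> C" "w \<notin> C"
    and conn: "\<And>l. l \<in> {1..n} \<Longrightarrow> (u, leaf l) \<in> (adjacency E)\<^sup>*"
    and L: "{l \<in> {1..n}. leaf l \<in> C} = L"
  shows "leaves_on_side n E leaf {u, w} u = L"
    and "leaves_on_side n E leaf {u, w} w = {1..n} - L"
proof -
  have cl: "v \<in> C \<longleftrightarrow> x \<in> C" if "(v, x) \<in> (adjacency (E - {{u, w}}))\<^sup>*" for v x
    by (rule reachable_in_closed[OF that]) (use closed in auto)
  have dich: "(u, leaf l) \<in> (adjacency (E - {{u, w}}))\<^sup>*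
      \<or> (w, leaf l) \<in> (adjacency (E - {{u, w}}))\<^sup>*" if "l \<in> {1..n}" for l
    by (rule reachable_without_edge[OF conn[OF that]])
  show "leaves_on_side n E leaf {u, w} u = L" "leaves_on_side n E leaf {u, w} w = {1..n} - L"
    unfolding leaves_on_side_def L[symmetric] using cl dich uw by blast+
qed

subsection \<open>The train track tree\<close>

lemma tt_connected:
  assumes "3 \<le> n"
  shows "l \<in> {1..n} \<Longrightarrow> (Inner 2, Leaf l) \<in> (adjacency (tt_edges n))\<^sup>*"
    and "i \<in> {2..<n} \<Longrightarrow> (Inner 2, Inner i) \<in> (adjacency (tt_edges n))\<^sup>*"
proof -
  have inner: "i \<in> {2..<n} \<Longrightarrow> (Inner 2, Inner i) \<in> (adjacency (tt_edges n))\<^sup>*" for i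
  proof (induction i)
    case (Suc i)
    show ?case
    proof (cases "i \<ge> 2")
      case True
      hence "(Inner i, Inner (Suc i)) \<in> adjacency (tt_edges n)"
        using Suc.prems by (auto simp: tt_edges_def)
      thus ?thesis using True Suc by (auto intro: rtrancl_into_rtrancl)
    next
      case False
      hence "Suc i = 2" using Suc.prems by auto
      thus ?thesis by (simp only: rtrancl.rtrancl_refl)
    qed
  qed auto
  show "i \<in> {2..<n} \<Longrightarrow> (Inner 2, Inner i) \<in> (adjacency (tt_edges n))\<^sup>*" by (rule inner)
  assume l: "l \<in> {1..n}"
  define i where "i = (if l = 1 then 2 else if l = n then n - 1 else l)"
  have "i \<in> {2..<n}" "(Inner i, Leaf l) \<in> adjacency (tt_edges n)"
    using l assms by (auto simp: i_def tt_edges_def insert_commute)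
  thus "(Inner 2, Leaf l) \<in> (adjacency (tt_edges n))\<^sup>*"
    using inner[of i] by (auto intro: rtrancl_into_rtrancl)
qed

lemma tt_connected_from:
  assumes "3 \<le> n" "u \<in> Leaf ` {1..n} \<union> Inner ` {2..<n}" "l \<in> {1..n}"
  shows "(u, Leaf l) \<in> (adjacency (tt_edges n))\<^sup>*"
  using assms tt_connected[OF assms(1)]
  by (blast intro: rtrancl_trans adjacency_rtrancl_sym)

text \<open>The three kinds of leaf edges are merged into one case. The last equation makes the
  inner end a function of \<open>l\<close>, so a leaf edge is determined by its leaf.\<close>

lemma tt_edge_cases:
  assumes "3 \<le> n" "e \<in> tt_edges n"
  obtains (inner) i where "e = {Inner i, Inner (i + 1)}" "2 \<le> i" "i + 1 < n"
    | (leaf) l i where "e = {Leaf l, Inner i}" "l \<in> {1..n}" "i \<in> {2..<n}"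
      "i = (if l = 1 then 2 else if l = n then n - 1 else l)"
proof -
  from assms have "(\<exists>i. e = {Inner i, Inner (i + 1)} \<and> 2 \<le> i \<and> i + 1 < n) \<or>
    (\<exists>i. e = {Leaf i, Inner i} \<and> 2 \<le> i \<and> i < n) \<or> e = {Leaf 1, Inner 2} \<or> e = {Leaf n, Inner (n - 1)}"
    by (auto simp: tt_edges_def)
  thus thesis
  proof (elim disjE exE conjE)
    fix i assume "e = {Leaf i, Inner i}" "2 \<le> i" "i < n"
    thus thesis by (intro leaf[of i i]) auto
  next
    assume "e = {Leaf 1, Inner 2}"
    thus thesis using assms(1) by (intro leaf[of 1 2]) auto
  next
    assume "e = {Leaf n, Inner (n - 1)}"
    thus thesis using assms(1) by (intro leaf[of n "n - 1"]) auto
  qed (rule inner)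
qed

lemma tt_inner_sides:
  assumes "3 \<le> n" "2 \<le> i" "i + 1 < n"
  shows "leaves_on_side n (tt_edges n) Leaf {Inner i, Inner (i + 1)} (Inner i) = {1..i}"
    and "leaves_on_side n (tt_edges n) Leaf {Inner i, Inner (i + 1)} (Inner (i + 1)) = {1..n} - {1..i}"
proof -
  \<comment> \<open>The exceptional leaf edges do not cross this cut: \<open>Leaf 1\<close> and
    \<open>Inner 2\<close> are both inside because 2 \<le> i, \<open>Leaf n\<close> and
    \<open>Inner (n - 1)\<close> both outside because i + 1 < n.\<close>
  let ?C = "Leaf ` {..i} \<union> Inner ` {..i}"
  have closed: "v \<in> ?C \<longleftrightarrow> w \<in> ?C"
    if vw: "{v, w} \<in> tt_edges n" "{v, w} \<noteq> {Inner i, Inner (i + 1)}" for v w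
    using assms(1) vw(1)
  proof (cases rule: tt_edge_cases)
    case (inner j)
    hence "j \<noteq> i" using vw(2) by auto
    thus ?thesis using inner by (auto simp: doubleton_eq_iff)
  next
    case (leaf l j)
    thus ?thesis using assms by (auto simp: doubleton_eq_iff split: if_splits)
  qed
  have conn: "(Inner i, Leaf l) \<in> (adjacency (tt_edges n))\<^sup>*" if "l \<in> {1..n}" for l
    using assms that by (intro tt_connected_from) auto
  have L: "{l \<in> {1..n}. Leaf l \<in> ?C} = {1..i}" using assms by auto
  show "leaves_on_side n (tt_edges n) Leaf {Inner i, Inner (i + 1)} (Inner i) = {1..i}"
    "leaves_on_side n (tt_edges n) Leaf {Inner i, Inner (i + 1)} (Inner (i + 1)) = {1..n} - {1..i}"
    by (rule leaves_on_side_eq[OF closed _ _ conn L]; auto)+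
qed

lemma tt_leaf_sides:
  assumes "3 \<le> n" "l \<in> {1..n}" "{Leaf l, Inner i} \<in> tt_edges n"
  shows "leaves_on_side n (tt_edges n) Leaf {Leaf l, Inner i} (Leaf l) = {l}"
    and "leaves_on_side n (tt_edges n) Leaf {Leaf l, Inner i} (Inner i) = {1..n} - {l}"
proof -
  have i: "i = (if l = 1 then 2 else if l = n then n - 1 else l)"
    using assms(1,3) by (cases rule: tt_edge_cases) (auto simp: doubleton_eq_iff)
  let ?C = "{Leaf l}"
  have closed: "v \<in> ?C \<longleftrightarrow> w \<in> ?C"
    if vw: "{v, w} \<in> tt_edges n" "{v, w} \<noteq> {Leaf l, Inner i}" for v w
    using assms(1) vw(1)
  proof (cases rule: tt_edge_cases)
    case (leaf l' j)
    hence "l' \<noteq> l" using vw(2) i by auto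
    thus ?thesis using leaf by (auto simp: doubleton_eq_iff)
  qed (auto simp: doubleton_eq_iff)
  have conn: "(Leaf l, Leaf l') \<in> (adjacency (tt_edges n))\<^sup>*" if "l' \<in> {1..n}" for l'
    using assms that by (intro tt_connected_from) auto
  have L: "{l' \<in> {1..n}. Leaf l' \<in> ?C} = {l}" using assms by auto
  show "leaves_on_side n (tt_edges n) Leaf {Leaf l, Inner i} (Leaf l) = {l}"
    "leaves_on_side n (tt_edges n) Leaf {Leaf l, Inner i} (Inner i) = {1..n} - {l}"
    by (rule leaves_on_side_eq[OF closed _ _ conn L]; simp)+
qed

lemma tt_sides_two:
  "leaves_on_side 2 (tt_edges 2) Leaf {Leaf 1, Leaf 2} (Leaf 1) = {1}"
  "leaves_on_side 2 (tt_edges 2) Leaf {Leaf 1, Leaf 2} (Leaf 2) = {1..2} - {1}"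
proof -
  have E: "tt_edges 2 = {{Leaf 1, Leaf 2}}" by (simp add: tt_edges_def)
  have conn: "(Leaf 1, Leaf l) \<in> (adjacency {{Leaf 1, Leaf 2}})\<^sup>*" if "l \<in> {1..2}" for l
  proof -
    have "l = 1 \<or> l = 2" using that by auto
    thus ?thesis by (auto intro: r_into_rtrancl)
  qed
  have L: "{l \<in> {1..2}. Leaf l \<in> {Leaf 1}} = {1}" by auto
  show "leaves_on_side 2 (tt_edges 2) Leaf {Leaf 1, Leaf 2} (Leaf 1) = {1}"
    "leaves_on_side 2 (tt_edges 2) Leaf {Leaf 1, Leaf 2} (Leaf 2) = {1..2} - {1}"
    unfolding E by (rule leaves_on_side_eq[OF _ _ _ conn L]; simp)+
qed

lemma tt_side_cases:
  assumes "2 \<le> n" "e \<in> tt_edges n" "u \<in> e"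
  obtains (prefix) j where "1 \<le> j" "j < n" "leaves_on_side n (tt_edges n) Leaf e u = {1..j}"
    | (suffix) j where "1 \<le> j" "j < n" "leaves_on_side n (tt_edges n) Leaf e u = {1..n} - {1..j}"
    | (single) l where "l \<in> {1..n}" "leaves_on_side n (tt_edges n) Leaf e u = {l}"
    | (cosingle) l where "l \<in> {1..n}" "leaves_on_side n (tt_edges n) Leaf e u = {1..n} - {l}"
proof (cases "n = 2")
  case True
  hence "e = {Leaf 1, Leaf 2}" using assms(2) by (simp add: tt_edges_def)
  thus thesis using assms(3) single[of 1] cosingle[of 1] tt_sides_two True by auto
next
  case False
  hence n: "3 \<le> n" using assms(1) by simp
  from n assms(2) show thesis
  proof (cases rule: tt_edge_cases)
    case (inner i)
    thus ?thesis using assms(3) n prefix[of i] suffix[of i] tt_inner_sides[of n i] by auto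
  next
    case (leaf l i)
    hence "u = Leaf l \<or> u = Inner i" using assms(3) by auto
    thus ?thesis
      using single[OF leaf(2)] cosingle[OF leaf(2)] tt_leaf_sides[of n l i] leaf(1,2) assms(2) n
      by metis
  qed
qed

text \<open>For n \<ge> 3 the lengths 1 and n - 1 come from the edges at the leaves 1 and n, the
  latter seen from its inner end; all other lengths come from edges between inner vertices.\<close>

lemma tt_prefix_side:
  assumes "1 \<le> j" "j < n"
  obtains e u where "e \<in> tt_edges n" "u \<in> e"
    "leaves_on_side n (tt_edges n) Leaf e u = {1..j}"
proof (cases "n = 2")
  case True
  hence j: "j = 1" using assms by simp
  show thesis
  proof (rule that)
    show "{Leaf 1, Leaf 2} \<in> tt_edges n" using True by (simp add: tt_edges_def)
    show "leaves_on_side n (tt_edges n) Leaf {Leaf 1, Leaf 2} (Leaf 1) = {1..j}"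
      unfolding True j using tt_sides_two(1) by simp
  qed simp
next
  case False
  hence n: "3 \<le> n" using assms by simp
  consider "j = 1" | "j = n - 1" | "2 \<le> j" "j + 1 < n" using assms by linarith
  thus thesis
  proof cases
    case 1
    have "{Leaf 1, Inner 2} \<in> tt_edges n" using n by (simp add: tt_edges_def)
    thus thesis using 1 n tt_leaf_sides[of n 1 2] that[of "{Leaf 1, Inner 2}" "Leaf 1"] by simp
  next
    case 2
    have "{Leaf n, Inner (n - 1)} \<in> tt_edges n" using n by (simp add: tt_edges_def)
    moreover have "{1..n} - {n} = {1..j}" using 2 n by auto
    ultimately show thesis
      using n tt_leaf_sides[of n n "n - 1"] that[of "{Leaf n, Inner (n - 1)}" "Inner (n - 1)"]
      by simp
  next
    case 3
    hence "{Inner j, Inner (j + 1)} \<in> tt_edges n" using n by (auto simp: tt_edges_def)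
    thus thesis
      using n 3 tt_inner_sides[of n j] that[of "{Inner j, Inner (j + 1)}" "Inner j"] by simp
  qed
qed

subsection \<open>The almost perfect binary tree\<close>

lemma exI2: "P a b \<Longrightarrow> \<exists>a b. P a b"
  by blast

lemma n_eq_full_depth_excess:
  assumes "1 \<le> n"
  shows "n = 2 ^ full_depth n + excess n" and "excess n < 2 ^ full_depth n"
  using floor_log_exp2_le[of n] floor_log_exp2_gt[of n] assms
  by (auto simp: excess_def full_depth_def)

lemma full_depth_pos: "2 \<le> n \<Longrightarrow> 1 \<le> full_depth n"
  using floor_log_rec[of n] by (simp add: full_depth_def)

definition apb_vertices :: "nat \<Rightarrow> (nat \<times> nat) set" where
  "apb_vertices n = {(j, i). j \<le> full_depth n \<and> i < 2 ^ j
     \<or> j = full_depth n + 1 \<and> i < 2 * excess n}"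

text \<open>The other end of the edge above a vertex, in the unrooted tree.\<close>

definition apb_up :: "nat \<times> nat \<Rightarrow> nat \<times> nat" where
  "apb_up = (\<lambda>(a, b). if a = 1 then (1, 1 - b) else (a - 1, b div 2))"

text \<open>Going up one level halves the horizontal position, so these are the descendants of
  \<open>(a, b)\<close>, itself included, in a binary tree without bottom row.\<close>

definition subtree :: "nat \<Rightarrow> nat \<Rightarrow> (nat \<times> nat) set" where
  "subtree a b = {(j, i). a \<le> j \<and> i div 2 ^ (j - a) = b}"

text \<open>Each vertex but the root has exactly one edge above it, so the edges are reindexed by
  their lower instead of their upper end.\<close>

lemma apb_rooted_edge_iff:
  "e \<in> apb_rooted_edges n \<longleftrightarrow>
    (\<exists>a b. (a, b) \<in> apb_vertices n \<and> 1 \<le> a \<and> e = {(a, b), (a - 1, b div 2)})"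
proof
  assume "e \<in> apb_rooted_edges n"
  then obtain j i where ji: "(j, i) \<in> apb_inner n"
    "e = {(j, i), (j + 1, 2 * i)} \<or> e = {(j, i), (j + 1, 2 * i + 1)}"
    unfolding apb_rooted_edges_def by blast
  from ji(2) obtain c where "c < 2" "e = {(j, i), (j + 1, 2 * i + c)}"
  proof
    assume "e = {(j, i), (j + 1, 2 * i)}"
    thus thesis by (intro that[of 0]) simp_all
  next
    assume "e = {(j, i), (j + 1, 2 * i + 1)}"
    thus thesis by (intro that[of 1]) simp_all
  qed
  note jic = ji(1) this
  have "i < 2 ^ j \<Longrightarrow> 2 * i + c < 2 ^ (j + 1)" using jic(2) by auto
  hence "(j + 1, 2 * i + c) \<in> apb_vertices n"
    using jic(1,2) by (auto simp: apb_inner_def apb_vertices_def)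
  moreover have "e = {(j + 1, 2 * i + c), (j + 1 - 1, (2 * i + c) div 2)}"
    using jic(2,3) by (auto simp: insert_commute)
  ultimately show "\<exists>a b. (a, b) \<in> apb_vertices n \<and> 1 \<le> a \<and> e = {(a, b), (a - 1, b div 2)}"
    by (intro exI2[of _ "j + 1" "2 * i + c"]) simp
next
  assume "\<exists>a b. (a, b) \<in> apb_vertices n \<and> 1 \<le> a \<and> e = {(a, b), (a - 1, b div 2)}"
  then obtain a b where ab: "(a, b) \<in> apb_vertices n" "1 \<le> a" "e = {(a, b), (a - 1, b div 2)}"
    by blast
  obtain j where j: "a = Suc j" using ab(2) by (cases a) auto
  have "(j, b div 2) \<in> apb_inner n"
    using ab(1) j by (auto simp: apb_inner_def apb_vertices_def)
  moreover have "b = 2 * (b div 2) \<or> b = 2 * (b div 2) + 1" by linarith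
  hence "e = {(j, b div 2), (j + 1, 2 * (b div 2))} \<or> e = {(j, b div 2), (j + 1, 2 * (b div 2) + 1)}"
    using ab(3) j by (auto simp: insert_commute)
  ultimately show "e \<in> apb_rooted_edges n"
    unfolding apb_rooted_edges_def by blast
qed

text \<open>The merged edge joins \<open>(1, 0)\<close> and \<open>(1, 1)\<close> and counts as the
  edge above either one; this is why \<open>apb_up\<close> treats depth 1 separately.\<close>

lemma apb_edge_iff:
  assumes "2 \<le> n"
  shows "e \<in> apb_edges n \<longleftrightarrow>
    (\<exists>a b. (a, b) \<in> apb_vertices n \<and> 1 \<le> a \<and> e = {(a, b), apb_up (a, b)})"
proof -
  have row1: "(Suc 0, b) \<in> apb_vertices n \<longleftrightarrow> b < 2" for b
    using full_depth_pos[OF assms] by (auto simp: apb_vertices_def)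
  have root: "{(0, 0), v} \<in> apb_rooted_edges n \<longleftrightarrow> v = (1, 0) \<or> v = (1, 1)" for v
  proof
    assume "{(0, 0), v} \<in> apb_rooted_edges n"
    then obtain a b where ab: "(a, b) \<in> apb_vertices n" "1 \<le> a"
      "{(0, 0), v} = {(a, b), (a - 1, b div 2)}"
      unfolding apb_rooted_edge_iff by blast
    from ab(2,3) have "a = 1" "v = (a, b)" by (auto simp: doubleton_eq_iff)
    thus "v = (1, 0) \<or> v = (1, 1)" using ab(1) row1[of b] by auto
  next
    assume "v = (1, 0) \<or> v = (1, 1)"
    then obtain b where "v = (1, b)" "b < 2" by fastforce
    thus "{(0, 0), v} \<in> apb_rooted_edges n"
      unfolding apb_rooted_edge_iff using row1[of b]
      by (intro exI2[of _ 1 b]) (auto simp: insert_commute)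
  qed
  have "e \<in> apb_edges n \<longleftrightarrow> e = {(1, 0), (1, 1)} \<or>
    (\<exists>a b. (a, b) \<in> apb_vertices n \<and> 2 \<le> a \<and> e = {(a, b), (a - 1, b div 2)})"
  proof -
    have merged: "{{v, w} | v w. v \<noteq> w \<and> {(0, 0), v} \<in> apb_rooted_edges n \<and> {(0, 0), w} \<in> apb_rooted_edges n}
      = {{(1, 0), (1, 1)}}"
      unfolding root by auto
    have other: "e \<in> apb_rooted_edges n \<and> (0, 0) \<notin> e \<longleftrightarrow>
      (\<exists>a b. (a, b) \<in> apb_vertices n \<and> 2 \<le> a \<and> e = {(a, b), (a - 1, b div 2)})"
    proof
      assume L: "e \<in> apb_rooted_edges n \<and> (0, 0) \<notin> e"
      then obtain a b where ab: "(a, b) \<in> apb_vertices n" "1 \<le> a" "e = {(a, b), (a - 1, b div 2)}"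
        unfolding apb_rooted_edge_iff by blast
      have "a \<noteq> 1"
      proof
        assume "a = 1"
        hence "b div 2 = 0" using ab(1) row1[of b] by simp
        thus False using L ab(3) \<open>a = 1\<close> by simp
      qed
      thus "\<exists>a b. (a, b) \<in> apb_vertices n \<and> 2 \<le> a \<and> e = {(a, b), (a - 1, b div 2)}"
        using ab by (intro exI2[of _ a b]) auto
    next
      assume "\<exists>a b. (a, b) \<in> apb_vertices n \<and> 2 \<le> a \<and> e = {(a, b), (a - 1, b div 2)}"
      then obtain a b where ab: "(a, b) \<in> apb_vertices n" "2 \<le> a" "e = {(a, b), (a - 1, b div 2)}"
        by blast
      hence "(0, 0) \<notin> e" by auto
      moreover have "e \<in> apb_rooted_edges n"
        unfolding apb_rooted_edge_iff using ab by (intro exI2[of _ a b]) auto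
      ultimately show "e \<in> apb_rooted_edges n \<and> (0, 0) \<notin> e" by blast
    qed
    show ?thesis
      unfolding apb_edges_def unroot_def merged Un_iff singleton_iff mem_Collect_eq other
      by (rule disj_commute)
  qed
  also have "\<dots> \<longleftrightarrow> (\<exists>a b. (a, b) \<in> apb_vertices n \<and> 1 \<le> a \<and> e = {(a, b), apb_up (a, b)})"
  proof
    assume "e = {(1, 0), (1, 1)} \<or>
      (\<exists>a b. (a, b) \<in> apb_vertices n \<and> 2 \<le> a \<and> e = {(a, b), (a - 1, b div 2)})"
    thus "\<exists>a b. (a, b) \<in> apb_vertices n \<and> 1 \<le> a \<and> e = {(a, b), apb_up (a, b)}"
    proof
      assume "e = {(1, 0), (1, 1)}"
      thus ?thesis using row1[of 0] by (intro exI2[of _ 1 0]) (auto simp: apb_up_def)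
    next
      assume "\<exists>a b. (a, b) \<in> apb_vertices n \<and> 2 \<le> a \<and> e = {(a, b), (a - 1, b div 2)}"
      then obtain a b where "(a, b) \<in> apb_vertices n" "2 \<le> a" "e = {(a, b), (a - 1, b div 2)}"
        by blast
      thus ?thesis by (intro exI2[of _ a b]) (auto simp: apb_up_def)
    qed
  next
    assume "\<exists>a b. (a, b) \<in> apb_vertices n \<and> 1 \<le> a \<and> e = {(a, b), apb_up (a, b)}"
    then obtain a b where ab: "(a, b) \<in> apb_vertices n" "1 \<le> a" "e = {(a, b), apb_up (a, b)}"
      by blast
    show "e = {(1, 0), (1, 1)} \<or>
      (\<exists>a b. (a, b) \<in> apb_vertices n \<and> 2 \<le> a \<and> e = {(a, b), (a - 1, b div 2)})"
    proof (cases "a = 1")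
      case True
      hence "b = 0 \<or> b = 1" using ab(1) row1[of b] by auto
      thus ?thesis using ab(3) True by (auto simp: apb_up_def)
    next
      case False
      hence "2 \<le> a" using ab(2) by auto
      thus ?thesis using ab False
        by (intro disjI2 exI2[of _ a b]) (auto simp: apb_up_def)
    qed
  qed
  finally show ?thesis .
qed

lemma apb_connected:
  assumes "2 \<le> n" "(a, b) \<in> apb_vertices n" "1 \<le> a"
  shows "((1, 0), (a, b)) \<in> (adjacency (apb_edges n))\<^sup>*"
  using assms(3,2)
proof (induction a arbitrary: b rule: dec_induct)
  case base
  have "{(1, 0), (1, 1)} \<in> apb_edges n"
    unfolding apb_edge_iff[OF assms(1)] using full_depth_pos[OF assms(1)]
    by (intro exI2[of _ 1 0]) (auto simp: apb_up_def apb_vertices_def)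
  hence "((1, 0), (1, 1)) \<in> adjacency (apb_edges n)" by simp
  moreover have "b < 2"
    using base full_depth_pos[OF assms(1)] by (auto simp: apb_vertices_def)
  hence "b = 0 \<or> b = 1" by auto
  ultimately show ?case by (elim disjE) (simp_all add: r_into_rtrancl)
next
  case (step a)
  have "(a, b div 2) \<in> apb_vertices n"
    using step.prems n_eq_full_depth_excess[of n] assms(1) by (auto simp: apb_vertices_def)
  hence "((1, 0), (a, b div 2)) \<in> (adjacency (apb_edges n))\<^sup>*" by (rule step.IH)
  moreover have "{(a, b div 2), (Suc a, b)} \<in> apb_edges n"
    unfolding apb_edge_iff[OF assms(1)] using step
    by (intro exI2[of _ "Suc a" b]) (auto simp: apb_up_def)
  hence "((a, b div 2), (Suc a, b)) \<in> adjacency (apb_edges n)" by simp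
  ultimately show ?case by (rule rtrancl_into_rtrancl)
qed

text \<open>
  The position of the \<open>l\<close>-th leaf from the left in row \<open>full_depth n + 1\<close> of the perfect binary
  tree, each leaf of the row above being moved to the position of its left child.
\<close>

definition leaf_key :: "nat \<Rightarrow> nat \<Rightarrow> nat" where
  "leaf_key n l = (if l \<le> 2 * excess n then l - 1 else 2 * (l - 1 - excess n))"

text \<open>Since each division by 2 of the key climbs one level, this is the set of labels below
  position \<open>b\<close> at height \<open>u\<close> over the bottom row. Neither number is
  restricted, so a block may be empty or contain every label.\<close>

definition block :: "nat \<Rightarrow> (nat \<Rightarrow> nat) \<Rightarrow> nat \<Rightarrow> nat \<Rightarrow> nat set" where
  "block n \<pi> u b = {l \<in> {1..n}. leaf_key n (\<pi> l) div 2 ^ u = b}"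

lemma leaf_key_strict_mono:
  "l \<in> {1..n} \<Longrightarrow> l' \<in> {1..n} \<Longrightarrow> l < l' \<Longrightarrow> leaf_key n l < leaf_key n l'"
  by (auto simp: leaf_key_def)

lemma leaf_key_less_iff:
  "l \<in> {1..n} \<Longrightarrow> l' \<in> {1..n} \<Longrightarrow> leaf_key n l < leaf_key n l' \<longleftrightarrow> l < l'"
  by (metis leaf_key_strict_mono less_asym linorder_neqE_nat nat_neq_iff)

lemma leaf_key_eq_iff:
  "l \<in> {1..n} \<Longrightarrow> l' \<in> {1..n} \<Longrightarrow> leaf_key n l = leaf_key n l' \<longleftrightarrow> l = l'"
  by (metis leaf_key_strict_mono less_irrefl linorder_neqE_nat)

lemma leaf_key_less:
  assumes "l \<in> {1..n}"
  shows "leaf_key n l < 2 ^ (full_depth n + 1)"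
  using n_eq_full_depth_excess[of n] assms by (auto simp: leaf_key_def)

lemma odd_leaf_key: "odd (leaf_key n l) \<Longrightarrow> leaf_key n l < 2 * excess n"
  by (auto simp: leaf_key_def split: if_splits)

lemma leaf_key_surj:
  assumes "1 \<le> n" "even x \<and> x < 2 ^ (full_depth n + 1) \<or> x < 2 * excess n"
  shows "x \<in> leaf_key n ` {1..n}"
proof (cases "x < 2 * excess n")
  case True
  thus ?thesis using n_eq_full_depth_excess[OF assms(1)]
    by (intro image_eqI[of _ _ "x + 1"]) (auto simp: leaf_key_def)
next
  case False
  then obtain i where i: "x = 2 * i" using assms(2) by auto
  thus ?thesis using n_eq_full_depth_excess[OF assms(1)] False assms(2)
    by (intro image_eqI[of _ _ "i + 1 + excess n"]) (auto simp: leaf_key_def)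
qed

lemma natural_leaf_in_vertices:
  assumes "2 \<le> n" "l \<in> {1..n}"
  shows "natural_leaf n l \<in> apb_vertices n" "1 \<le> fst (natural_leaf n l)"
  using assms n_eq_full_depth_excess[of n] full_depth_pos[OF assms(1)]
  by (auto simp: natural_leaf_def apb_vertices_def)

text \<open>A leaf moved to the position of its left child stays below the same vertices of its own
  row and above. In the bottom row the moved keys are at least \<open>2 * excess n\<close>, so they
  meet no vertex there.\<close>

lemma natural_leaf_in_subtree_iff:
  assumes "(a, b) \<in> apb_vertices n" "l \<in> {1..n}"
  shows "natural_leaf n l \<in> subtree a b \<longleftrightarrow> leaf_key n l div 2 ^ (full_depth n + 1 - a) = b"
proof (cases "l \<le> 2 * excess n")
  case True
  thus ?thesis using assms(1)
    by (auto simp: natural_leaf_def subtree_def leaf_key_def apb_vertices_def)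
next
  case False
  show ?thesis
  proof (cases "a \<le> full_depth n")
    case True
    hence "2 ^ (full_depth n + 1 - a) = (2 * 2 ^ (full_depth n - a) :: nat)"
      by (simp add: Suc_diff_le)
    thus ?thesis using False True
      by (simp add: natural_leaf_def subtree_def leaf_key_def div_mult2_eq)
  next
    case a: False
    thus ?thesis using False assms
      by (auto simp: natural_leaf_def subtree_def leaf_key_def apb_vertices_def)
  qed
qed

lemma apb_sides:
  fixes \<pi> :: "nat \<Rightarrow> nat"
  assumes n: "2 \<le> n" and \<pi>: "\<pi> permutes {1..n}" and ab: "(a, b) \<in> apb_vertices n" "1 \<le> a"
  defines "leaf \<equiv> \<lambda>l. natural_leaf n (\<pi> l)" and "L \<equiv> block n \<pi> (full_depth n + 1 - a) b"
  shows "leaves_on_side n (apb_edges n) leaf {(a, b), apb_up (a, b)} (a, b) = L"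
    and "leaves_on_side n (apb_edges n) leaf {(a, b), apb_up (a, b)} (apb_up (a, b)) = {1..n} - L"
proof -
  let ?C = "subtree a b"
  have row1: "b' < 2" if "(Suc 0, b') \<in> apb_vertices n" for b'
    using full_depth_pos[OF n] that by (auto simp: apb_vertices_def)
  have closed1: "(a', b') \<in> ?C \<longleftrightarrow> apb_up (a', b') \<in> ?C"
    if v: "(a', b') \<in> apb_vertices n" "1 \<le> a'" "{(a', b'), apb_up (a', b')} \<noteq> {(a, b), apb_up (a, b)}"
    for a' b'
  proof (cases "a' = 1")
    case True
    \<comment> \<open>This edge is the merged one. A vertex of row 1 lies in the subtree only if it
      is \<open>(a, b)\<close> itself, and then the merged edge is the excluded one.\<close>
    have "(1, c) \<notin> ?C" if "c < 2" for c
    proof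
      assume "(1, c) \<in> ?C"
      hence "a = 1" "b = c" using ab(2) by (auto simp: subtree_def)
      moreover have "b' < 2" using row1 v(1) True by simp
      ultimately show False using v(3) True \<open>c < 2\<close>
        by (auto simp: apb_up_def doubleton_eq_iff)
    qed
    moreover have "b' < 2" using row1 v(1) True by simp
    ultimately show ?thesis using True by (simp add: apb_up_def)
  next
    case False
    hence up: "apb_up (a', b') = (a' - 1, b' div 2)" by (simp add: apb_up_def)
    consider "a \<le> a' - 1" | "a = a'" | "a' < a" using v(2) by linarith
    thus ?thesis
    proof cases
      case 1
      have "2 ^ (a' - a) = (2 * 2 ^ (a' - 1 - a) :: nat)"
        using 1 v(2) by (simp flip: power_Suc add: Suc_diff_le)
      moreover have "a \<le> a'" using 1 by linarith
      ultimately show ?thesis using 1 by (simp add: up subtree_def div_mult2_eq)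
    next
      case 2
      have "b' \<noteq> b" using v(3) 2 by auto
      thus ?thesis using 2 False v(2) by (auto simp: up subtree_def)
    next
      case 3
      thus ?thesis by (auto simp: up subtree_def)
    qed
  qed
  have closed: "v \<in> ?C \<longleftrightarrow> x \<in> ?C"
    if vx: "{v, x} \<in> apb_edges n" "{v, x} \<noteq> {(a, b), apb_up (a, b)}" for v x
  proof -
    obtain a' b' where v: "(a', b') \<in> apb_vertices n" "1 \<le> a'" "{v, x} = {(a', b'), apb_up (a', b')}"
      using vx(1) unfolding apb_edge_iff[OF n] by blast
    show ?thesis using closed1[OF v(1,2)] v(3) vx(2) by (metis doubleton_eq_iff)
  qed
  have conn: "((a, b), leaf l) \<in> (adjacency (apb_edges n))\<^sup>*" if "l \<in> {1..n}" for l
  proof -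
    have l: "\<pi> l \<in> {1..n}" using that \<pi> by (simp only: permutes_in_image)
    obtain a' b' where "leaf l = (a', b')" by (cases "leaf l")
    hence "((1, 0), leaf l) \<in> (adjacency (apb_edges n))\<^sup>*"
      using natural_leaf_in_vertices[OF n l] apb_connected[OF n, of a' b'] by (simp add: leaf_def)
    thus ?thesis using adjacency_rtrancl_sym[OF apb_connected[OF n ab]] by (rule rtrancl_trans[rotated])
  qed
  have L: "{l \<in> {1..n}. leaf l \<in> ?C} = L"
  proof -
    have "leaf l \<in> ?C \<longleftrightarrow> leaf_key n (\<pi> l) div 2 ^ (full_depth n + 1 - a) = b"
      if "l \<in> {1..n}" for l
    proof -
      have "\<pi> l \<in> {1..n}" using that \<pi> by (simp only: permutes_in_image)
      thus ?thesis unfolding leaf_def by (rule natural_leaf_in_subtree_iff[OF ab(1)])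
    qed
    thus ?thesis unfolding L_def block_def by blast
  qed
  have u: "(a, b) \<in> ?C" by (simp add: subtree_def)
  have w: "apb_up (a, b) \<notin> ?C"
    using ab row1[of b] by (auto simp: subtree_def apb_up_def less_2_cases_iff)
  show "leaves_on_side n (apb_edges n) leaf {(a, b), apb_up (a, b)} (a, b) = L"
    "leaves_on_side n (apb_edges n) leaf {(a, b), apb_up (a, b)} (apb_up (a, b)) = {1..n} - L"
    by (rule leaves_on_side_eq[OF closed u w conn L]; assumption)+
qed

lemma HH_side_cases:
  assumes "2 \<le> n" "\<pi> permutes {1..n}" "e \<in> apb_edges n" "v \<in> e"
  obtains u b where "leaves_on_side n (apb_edges n) (\<lambda>l. natural_leaf n (\<pi> l)) e v = block n \<pi> u b
    \<or> leaves_on_side n (apb_edges n) (\<lambda>l. natural_leaf n (\<pi> l)) e v = {1..n} - block n \<pi> u b"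
proof -
  obtain a b where ab: "(a, b) \<in> apb_vertices n" "1 \<le> a" "e = {(a, b), apb_up (a, b)}"
    using assms(3) unfolding apb_edge_iff[OF assms(1)] by blast
  thus thesis using apb_sides[OF assms(1,2) ab(1,2)] assms(4) that by blast
qed

text \<open>The climb along binary digits uses blocks at all heights and positions, including those
  that are no vertex of the tree; this reduces each of them to a side of an edge or a trivial
  set.\<close>

lemma block_eq_side:
  assumes n: "2 \<le> n" and \<pi>: "\<pi> permutes {1..n}"
  shows "block n \<pi> u b = {} \<or> block n \<pi> u b = {1..n} \<or>
    (\<exists>e\<in>apb_edges n. \<exists>v\<in>e.
      leaves_on_side n (apb_edges n) (\<lambda>l. natural_leaf n (\<pi> l)) e v = block n \<pi> u b)"
proof -
  have vertex: "\<exists>e\<in>apb_edges n. \<exists>v\<in>e.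
      leaves_on_side n (apb_edges n) (\<lambda>l. natural_leaf n (\<pi> l)) e v
        = block n \<pi> (full_depth n + 1 - a) b"
    if "(a, b) \<in> apb_vertices n" "1 \<le> a" for a b
  proof (intro bexI)
    show "{(a, b), apb_up (a, b)} \<in> apb_edges n"
      using that unfolding apb_edge_iff[OF n] by blast
  qed (use apb_sides[OF n \<pi> that] in auto)
  have key_less: "leaf_key n (\<pi> l) < 2 ^ (full_depth n + 1)" if "l \<in> {1..n}" for l
    using that \<pi> by (intro leaf_key_less) (simp only: permutes_in_image)
  consider "block n \<pi> u b = {}" | "full_depth n + 1 \<le> u"
    | l where "l \<in> block n \<pi> u b" "1 \<le> u" "u \<le> full_depth n"
    | l where "l \<in> block n \<pi> u b" "u = 0"
  proof (cases "block n \<pi> u b = {} \<or> full_depth n + 1 \<le> u")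
    case False
    then obtain l where "l \<in> block n \<pi> u b" by blast
    thus ?thesis using False that(3,4) by (cases "u = 0") auto
  qed (use that in blast)
  thus ?thesis
  proof cases
    case 2
    have "(2::nat) ^ (full_depth n + 1) \<le> 2 ^ u" using 2 by (intro power_increasing) auto
    hence "leaf_key n (\<pi> l) div 2 ^ u = 0" if "l \<in> {1..n}" for l
      using key_less[OF that] by simp
    thus ?thesis by (cases "b = 0") (auto simp: block_def)
  next
    case (3 l)
    have l: "l \<in> {1..n}" "leaf_key n (\<pi> l) div 2 ^ u = b" using 3(1) by (auto simp: block_def)
    have "2 ^ (full_depth n + 1) = (2 ^ (full_depth n + 1 - u) * 2 ^ u :: nat)"
      using 3 by (simp flip: power_add)
    hence "leaf_key n (\<pi> l) < 2 ^ (full_depth n + 1 - u) * 2 ^ u"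
      using key_less[OF l(1)] by (simp only:)
    hence "b < 2 ^ (full_depth n + 1 - u)"
      unfolding l(2)[symmetric] by (rule less_mult_imp_div_less)
    moreover have "full_depth n + 1 - u \<le> full_depth n" using 3(2) by linarith
    ultimately have "(full_depth n + 1 - u, b) \<in> apb_vertices n"
      unfolding apb_vertices_def by blast
    thus ?thesis using vertex[of "full_depth n + 1 - u" b] 3 by simp
  next
    case (4 l)
    have l: "l \<in> {1..n}" "leaf_key n (\<pi> l) = b" using 4 by (auto simp: block_def)
    show ?thesis
    proof (cases "b < 2 * excess n")
      case True
      thus ?thesis using vertex[of "full_depth n + 1" b] 4 by (simp add: apb_vertices_def)
    next
      case False
      have odd: "x < 2 * excess n" if "x = leaf_key n (\<pi> l')" "odd x" for l' x
        using that odd_leaf_key by blast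
      have "even b" using odd[of b l] l False by auto
      \<comment> \<open>Here \<open>b\<close> is the key of a leaf one row above the bottom. Its
        neighbour \<open>b + 1\<close> is odd and too large to be a key, so the block one level
        higher has no further element.\<close>
      have "block n \<pi> u b = block n \<pi> 1 (b div 2)"
      proof -
        have "x = b" if "x div 2 = b div 2" "x = leaf_key n (\<pi> l')" for x l'
          using that odd[of x l'] False \<open>even b\<close> by (cases "even x") (auto elim!: evenE oddE)
        thus ?thesis unfolding block_def 4(2) by auto
      qed
      moreover have "(full_depth n, b div 2) \<in> apb_vertices n"
        using key_less[OF l(1)] l(2) by (simp add: apb_vertices_def)
      ultimately show ?thesis using vertex[of "full_depth n" "b div 2"] full_depth_pos[OF n] by simp
    qed
  qed simp
qed

text \<open>The trivial blocks have rank at most 1, which is where \<open>1 \<le> r\<close>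
  enters.\<close>

lemma flattening_rank_block:
  assumes "2 \<le> n" "\<pi> permutes {1..n}" "t \<in> HH_labelled d n \<pi> r" "1 \<le> r"
  shows "flattening_rank d {1..n} (block n \<pi> u b) t \<le> r"
proof -
  have "flattening_rank d {1..n} {1..n} t = flattening_rank d {1..n} {} t"
    using flattening_rank_complement[of "{1..n}" "{}" d t] by simp
  hence "flattening_rank d {1..n} {1..n} t \<le> r" "flattening_rank d {1..n} {} t \<le> r"
    using flattening_rank_empty[of d "{1..n}" t] assms(4) by linarith+
  thus ?thesis
    using block_eq_side[OF assms(1,2), of u b] assms(3) unfolding HH_labelled_def TNS_def by force
qed

section \<open>Prefixes are cut off by few edges\<close>

text \<open>
  Climbing from the leaf with key \<open>\<kappa>\<close> to the root along the binary digits of \<open>\<kappa>\<close>, the first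
  (second) component bounds the number of edges that have to be cut in order to separate the
  leaves with key less than (at least) \<open>\<kappa>\<close> in the current block from all other leaves.
\<close>

fun cut_cost :: "nat \<Rightarrow> nat \<Rightarrow> nat \<times> nat" where
  "cut_cost \<kappa> 0 = (0, 1)"
| "cut_cost \<kappa> (Suc u) = (let (p, q) = cut_cost \<kappa> u in
     if even (\<kappa> div 2 ^ u) then (p, min p q + 1) else (min p q + 1, q))"

lemma div_power_Suc: "(x::nat) div 2 ^ Suc u = x div 2 ^ u div 2"
  by (simp only: power_Suc2 div_mult2_eq)

text \<open>Climb one level. If the digit is 0, the left part stays the same and the right part
  gains the sibling block; it is also the enclosing block minus the left part. Either description
  adds one factor \<open>r\<close>, so the cheaper one gives the minimum in \<open>cut_cost\<close>.
  Digit 1 is symmetric.\<close>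

lemma flattening_rank_digit_block:
  fixes f :: "nat \<Rightarrow> nat"
  assumes A: "finite A" and r: "1 \<le> r"
    and bl: "\<And>u b. flattening_rank d A {l \<in> A. f l div 2 ^ u = b} t \<le> r"
  shows "flattening_rank d A {l \<in> A. f l div 2 ^ u = \<kappa> div 2 ^ u \<and> f l < \<kappa>} t \<le> r ^ fst (cut_cost \<kappa> u)
    \<and> flattening_rank d A {l \<in> A. f l div 2 ^ u = \<kappa> div 2 ^ u \<and> \<kappa> \<le> f l} t \<le> r ^ snd (cut_cost \<kappa> u)"
proof (induction u)
  case 0
  have "{l \<in> A. f l div 2 ^ 0 = \<kappa> div 2 ^ 0 \<and> f l < \<kappa>} = {}"
    "{l \<in> A. f l div 2 ^ 0 = \<kappa> div 2 ^ 0 \<and> \<kappa> \<le> f l} = {l \<in> A. f l div 2 ^ 0 = \<kappa>}" by auto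
  thus ?case using bl[of 0 \<kappa>] flattening_rank_empty[of d A t] by (simp only:) simp
next
  case (Suc u)
  let ?R = "\<lambda>S. flattening_rank d A S t"
  define B where "B u b = {l \<in> A. f l div 2 ^ u = b}" for u b
  define X where "X u = {l \<in> A. f l div 2 ^ u = \<kappa> div 2 ^ u \<and> f l < \<kappa>}" for u
  define Y where "Y u = {l \<in> A. f l div 2 ^ u = \<kappa> div 2 ^ u \<and> \<kappa> \<le> f l}" for u
  obtain p q where pq: "cut_cost \<kappa> u = (p, q)" by fastforce
  have IH: "?R (X u) \<le> r ^ p" "?R (Y u) \<le> r ^ q"
    using Suc.IH pq by (simp_all add: X_def Y_def)
  have RB: "?R (B u b) \<le> r" for u b unfolding B_def by (rule bl)
  have sub: "X u \<subseteq> A" "Y u \<subseteq> A" "B u b \<subseteq> A" for u b by (auto simp: X_def Y_def B_def)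
  have min: "x \<le> r ^ (min p q + 1)" if "x \<le> r ^ p * r" "x \<le> r ^ q * r" for x
    using that by (simp add: min_def mult.commute)
  have lt: "x < y" if "x div 2 ^ u < y div 2 ^ u" for x y :: nat
    by (rule ccontr) (use that div_le_mono[of y x "2 ^ u"] in linarith)
  define c where "c = \<kappa> div 2 ^ Suc u"
  show ?case
  proof (cases "even (\<kappa> div 2 ^ u)")
    case True
    hence \<kappa>: "\<kappa> div 2 ^ u = 2 * c" unfolding c_def div_power_Suc by simp
    have iff: "x div 2 ^ Suc u = c \<longleftrightarrow> x div 2 ^ u = 2 * c \<or> x div 2 ^ u = 2 * c + 1" for x
      unfolding div_power_Suc[of x] by linarith
    have gt: "\<kappa> < x" if "x div 2 ^ u = 2 * c + 1" for x by (rule lt) (simp add: that \<kappa>)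
    have "x div 2 ^ Suc u = c \<and> x < \<kappa> \<longleftrightarrow> x div 2 ^ u = 2 * c \<and> x < \<kappa>" for x
      using iff[of x] gt[of x] less_asym by blast
    hence X: "X (Suc u) = X u"
      unfolding X_def c_def[symmetric] \<kappa> by blast
    have "x div 2 ^ Suc u = c \<and> \<kappa> \<le> x \<longleftrightarrow>
        x div 2 ^ u = 2 * c \<and> \<kappa> \<le> x \<or> x div 2 ^ u = 2 * c + 1" for x
      using iff[of x] gt[of x] less_imp_le by blast
    hence Y1: "Y (Suc u) = Y u \<union> B u (2 * c + 1)"
      unfolding Y_def B_def c_def[symmetric] \<kappa> by blast
    have Y2: "Y (Suc u) = B (Suc u) c - X u"
      unfolding c_def X[symmetric] unfolding Y_def B_def X_def by auto
    have "Y u \<inter> B u (2 * c + 1) = {}" unfolding Y_def B_def using \<kappa> by auto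
    hence "?R (Y (Suc u)) \<le> ?R (Y u) * ?R (B u (2 * c + 1))"
      unfolding Y1 using A sub by (intro flattening_rank_Un) auto
    also have "\<dots> \<le> r ^ q * r" by (intro mult_mono IH RB) auto
    finally have 1: "?R (Y (Suc u)) \<le> r ^ q * r" .
    have "X u \<subseteq> B (Suc u) c" unfolding X[symmetric] by (auto simp: X_def B_def c_def)
    hence "?R (Y (Suc u)) \<le> ?R (B (Suc u) c) * ?R (X u)"
      unfolding Y2 using A sub by (intro flattening_rank_Diff) auto
    also have "\<dots> \<le> r * r ^ p" by (intro mult_mono IH RB) auto
    finally have "?R (Y (Suc u)) \<le> r ^ p * r" by (simp only: mult.commute)
    from min[OF this 1] have "?R (Y (Suc u)) \<le> r ^ snd (cut_cost \<kappa> (Suc u))"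
      using pq True by simp
    moreover have "?R (X (Suc u)) \<le> r ^ fst (cut_cost \<kappa> (Suc u))"
      unfolding X using IH pq True by simp
    ultimately show ?thesis unfolding X_def Y_def by blast
  next
    case False
    hence \<kappa>: "\<kappa> div 2 ^ u = 2 * c + 1" unfolding c_def div_power_Suc by simp
    have iff: "x div 2 ^ Suc u = c \<longleftrightarrow> x div 2 ^ u = 2 * c \<or> x div 2 ^ u = 2 * c + 1" for x
      unfolding div_power_Suc[of x] by linarith
    have gt: "x < \<kappa>" if "x div 2 ^ u = 2 * c" for x by (rule lt) (simp add: that \<kappa>)
    have "x div 2 ^ Suc u = c \<and> \<kappa> \<le> x \<longleftrightarrow> x div 2 ^ u = 2 * c + 1 \<and> \<kappa> \<le> x" for x
      using iff[of x] gt[of x] leD by blast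
    hence Y: "Y (Suc u) = Y u"
      unfolding Y_def c_def[symmetric] \<kappa> by blast
    have "x div 2 ^ Suc u = c \<and> x < \<kappa> \<longleftrightarrow>
        x div 2 ^ u = 2 * c + 1 \<and> x < \<kappa> \<or> x div 2 ^ u = 2 * c" for x
      using iff[of x] gt[of x] by blast
    hence X1: "X (Suc u) = X u \<union> B u (2 * c)"
      unfolding X_def B_def c_def[symmetric] \<kappa> by blast
    have X2: "X (Suc u) = B (Suc u) c - Y u"
      unfolding c_def Y[symmetric] unfolding Y_def B_def X_def by auto
    have "X u \<inter> B u (2 * c) = {}" unfolding X_def B_def using \<kappa> by auto
    hence "?R (X (Suc u)) \<le> ?R (X u) * ?R (B u (2 * c))"
      unfolding X1 using A sub by (intro flattening_rank_Un) auto
    also have "\<dots> \<le> r ^ p * r" by (intro mult_mono IH RB) auto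
    finally have 1: "?R (X (Suc u)) \<le> r ^ p * r" .
    have "Y u \<subseteq> B (Suc u) c" unfolding Y[symmetric] by (auto simp: Y_def B_def c_def)
    hence "?R (X (Suc u)) \<le> ?R (B (Suc u) c) * ?R (Y u)"
      unfolding X2 using A sub by (intro flattening_rank_Diff) auto
    also have "\<dots> \<le> r * r ^ q" by (intro mult_mono IH RB) auto
    finally have "?R (X (Suc u)) \<le> r ^ q * r" by (simp only: mult.commute)
    from min[OF 1 this] have "?R (X (Suc u)) \<le> r ^ fst (cut_cost \<kappa> (Suc u))"
      using pq False by simp
    moreover have "?R (Y (Suc u)) \<le> r ^ snd (cut_cost \<kappa> (Suc u))"
      unfolding Y using IH pq False by simp
    ultimately show ?thesis unfolding X_def Y_def by blast
  qed
qed

section \<open>Arithmetic of the cut costs\<close>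

lemma cut_cost_sum_le:
  "fst (cut_cost \<kappa> u) + snd (cut_cost \<kappa> u) \<le> u + 1"
  by (induction u) (auto simp: case_prod_unfold Let_def)

text \<open>The first digit 0 leaves the initial pair (0, 1) unchanged, and every later digit raises
  the sum by at most one.\<close>

lemma cut_cost_sum_le_even:
  "even \<kappa> \<Longrightarrow> fst (cut_cost \<kappa> (Suc u)) + snd (cut_cost \<kappa> (Suc u)) \<le> u + 1"
  by (induction u) (auto simp: case_prod_unfold Let_def)

lemma cut_cost_close:
  "fst (cut_cost \<kappa> u) \<le> snd (cut_cost \<kappa> u) + 1 \<and> snd (cut_cost \<kappa> u) \<le> fst (cut_cost \<kappa> u) + 1"
  by (induction u) (auto simp: case_prod_unfold Let_def)

text \<open>
  Among each further pair of digits there must be a nonzero one, so the smallest such \<open>\<kappa>\<close> is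
  \<open>1 + 2 + 8 + \<dots> + 2 \<cdot> 4\<^bsup>t - 1\<^esup>\<close>.
\<close>

lemma cut_cost_maximal:
  assumes "t + 1 \<le> fst (cut_cost \<kappa> (2 * t + 1))" "t + 1 \<le> snd (cut_cost \<kappa> (2 * t + 1))"
  shows "2 * 4 ^ t + 1 \<le> 3 * (\<kappa> mod 2 ^ (2 * t + 1))"
  using assms
proof (induction t)
  case 0
  thus ?case by (auto simp: Let_def split: if_splits elim!: oddE)
next
  case (Suc t)
  let ?z = "\<kappa> div 2 ^ (2 * t + 1)"
  obtain p q where pq: "cut_cost \<kappa> (2 * t + 1) = (p, q)" by fastforce
  have sum: "p + q \<le> 2 * t + 2" "p \<le> q + 1" "q \<le> p + 1"
    using cut_cost_sum_le[of \<kappa> "2 * t + 1"] cut_cost_close[of \<kappa> "2 * t + 1"] pq by auto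
  have idx: "2 * Suc t + 1 = Suc (Suc (2 * t + 1))" by simp
  have z2: "\<kappa> div 2 ^ Suc (2 * t + 1) = ?z div 2" by (rule div_power_Suc)
  have digits: "1 \<le> z mod 4" if "\<not> (even z \<and> even (z div 2))" for z :: nat
    using that by presburger
  \<comment> \<open>The sum gains at most one per digit and must reach 2 * t + 4; with the costs
    differing by at most one this forces p = q = t + 1, and two digits 0 would leave
    \<open>p\<close> there.\<close>
  have max: "\<not> (even ?z \<and> even (?z div 2)) \<and> t + 1 \<le> p \<and> t + 1 \<le> q"
    using Suc.prems sum unfolding idx cut_cost.simps(2) z2 pq
    by (auto simp: Let_def min_def split: if_splits)
  have z: "1 \<le> ?z mod 4" by (rule digits) (use max in blast)
  have IH: "2 * 4 ^ t + 1 \<le> 3 * (\<kappa> mod 2 ^ (2 * t + 1))"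
    using max by (intro Suc.IH) (simp_all only: pq fst_conv snd_conv)
  have "(2::nat) ^ (2 * Suc t + 1) = 2 ^ (2 * t + 1) * 4" by simp
  hence "\<kappa> mod 2 ^ (2 * Suc t + 1) = 2 ^ (2 * t + 1) * (?z mod 4) + \<kappa> mod 2 ^ (2 * t + 1)"
    by (simp only: mod_mult2_eq)
  moreover have "2 ^ (2 * t + 1) \<le> 2 ^ (2 * t + 1) * (?z mod 4)"
    using z by (simp only: mult_le_mono2[of 1, simplified mult_1_right])
  moreover have "(2::nat) ^ (2 * t + 1) = 2 * 4 ^ t" "(4::nat) ^ Suc t = 4 * 4 ^ t"
    by (simp_all add: power_mult)
  \<comment> \<open>The new digits contribute at least 2 * 4 ^ t, and 3 * 2 * 4 ^ t + 2 * 4 ^ t = 2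
    * 4 ^ (t + 1).\<close>
  ultimately show ?case using IH by linarith
qed

text \<open>The geometric sum; it fails at k = 0 because of the convention
  \<open>threshold 0 = 0\<close>.\<close>

lemma threshold_eq:
  assumes "1 \<le> k"
  shows "3 * threshold k + 1 = 4 ^ (k + 1)"
proof -
  have "3 * (\<Sum>i=0..k. 4 ^ i) + 1 = (4 ^ (k + 1) :: nat)" for k by (induction k) auto
  thus ?thesis using assms by (simp add: threshold_def)
qed

text \<open>Two costs above \<open>k\<close> need at least 2 * k + 1 digits, while the bound on
  \<open>n\<close> keeps the depth below 2 * k + 1, so the depth is 2 * k and no digit is wasted.
  The key is then odd, hence in the bottom row and below \<open>2 * excess n\<close>, which
  contradicts its lower bound from \<open>cut_cost_maximal\<close>.\<close>

lemma cut_cost_leaf_key: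
  assumes k: "1 \<le> k" and n: "2 \<le> n" "n \<le> threshold k" and l: "l \<in> {1..n}"
  defines "c \<equiv> cut_cost (leaf_key n l) (full_depth n + 1)"
  shows "min (fst c) (snd c) \<le> k"
proof (rule ccontr)
  assume "\<not> min (fst c) (snd c) \<le> k"
  hence c: "k + 1 \<le> fst c" "k + 1 \<le> snd c" by auto
  let ?h = "full_depth n" and ?m = "excess n" and ?\<kappa> = "leaf_key n l"
  have hm: "n = 2 ^ ?h + ?m" using n by (intro n_eq_full_depth_excess) simp
  have n3: "3 * n + 1 \<le> 4 * 4 ^ k" using threshold_eq[OF k] n(2) by simp
  have "?h < 2 * k + 1"
  proof (rule ccontr)
    assume "\<not> ?thesis"
    hence "(2::nat) ^ (2 * k + 1) \<le> 2 ^ ?h" by (intro power_increasing) auto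
    moreover have "(2::nat) ^ (2 * k + 1) = 2 * 4 ^ k" by (simp add: power_mult)
    ultimately show False using hm n3 by linarith
  qed
  moreover have "2 * k + 2 \<le> ?h + 2"
    using c cut_cost_sum_le[of ?\<kappa> "?h + 1"] unfolding c_def by linarith
  ultimately have h: "?h = 2 * k" by simp
  have "odd ?\<kappa>"
    using c cut_cost_sum_le_even[of ?\<kappa> ?h] h unfolding c_def by fastforce
  hence "?\<kappa> < 2 * ?m" by (rule odd_leaf_key)
  moreover have "2 * 4 ^ k + 1 \<le> 3 * (?\<kappa> mod 2 ^ (2 * k + 1))"
    using c unfolding c_def h by (rule cut_cost_maximal)
  moreover have "?\<kappa> mod 2 ^ (2 * k + 1) \<le> ?\<kappa>" by simp
  moreover have "(2::nat) ^ ?h = 4 ^ k" by (simp add: h power_mult)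
  ultimately show False using hm n3 by linarith
qed

section \<open>The inclusion for the natural order\<close>

lemma flattening_rank_prefix:
  assumes k: "1 \<le> k" and n: "2 \<le> n" "n \<le> threshold k" and r: "1 \<le> r"
    and t: "t \<in> HH d n r" and j: "1 \<le> j" "j < n"
  shows "flattening_rank d {1..n} {1..j} t \<le> r ^ k"
proof -
  \<comment> \<open>The prefix consists of the leaves strictly to the left of leaf
    \<open>j + 1\<close>; at height \<open>D\<close> the current block contains all leaves.\<close>
  define \<kappa> where "\<kappa> = leaf_key n (j + 1)"
  define D where "D = full_depth n + 1"
  let ?R = "\<lambda>S. flattening_rank d {1..n} S t"
  have bl: "?R {l \<in> {1..n}. leaf_key n l div 2 ^ u = b} \<le> r" for u b
    using flattening_rank_block[OF n(1) permutes_id t[unfolded HH_def] r, of u b]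
    by (simp add: block_def)
  have j1: "j + 1 \<in> {1..n}" using j by auto
  have div0: "leaf_key n l div 2 ^ D = 0" if "l \<in> {1..n}" for l
    using leaf_key_less[OF that] by (simp add: D_def del: power_Suc)
  have X: "{l \<in> {1..n}. leaf_key n l div 2 ^ D = \<kappa> div 2 ^ D \<and> leaf_key n l < \<kappa>} = {1..j}"
    using j j1 by (auto simp: \<kappa>_def div0 leaf_key_less_iff)
  have Y: "{l \<in> {1..n}. leaf_key n l div 2 ^ D = \<kappa> div 2 ^ D \<and> \<kappa> \<le> leaf_key n l} = {1..n} - {1..j}"
    using j j1 by (auto simp: \<kappa>_def div0 leaf_key_less_iff not_less[symmetric])
  have "?R {1..j} \<le> r ^ fst (cut_cost \<kappa> D)" "?R ({1..n} - {1..j}) \<le> r ^ snd (cut_cost \<kappa> D)"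
    using flattening_rank_digit_block[OF _ r bl, of D \<kappa>] unfolding X Y by auto
  \<comment> \<open>The prefix and its complement have equal rank, so the smaller of the two costs
    decides.\<close>
  moreover have "?R ({1..n} - {1..j}) = ?R {1..j}"
    using j by (intro flattening_rank_complement) auto
  ultimately have "?R {1..j} \<le> r ^ min (fst (cut_cost \<kappa> D)) (snd (cut_cost \<kappa> D))"
    by (simp add: min_def)
  also have "\<dots> \<le> r ^ k"
    using cut_cost_leaf_key[OF k n j1] r by (intro power_increasing) (simp_all add: \<kappa>_def D_def)
  finally show ?thesis .
qed

text \<open>Covers r = 0 as well: for n \<ge> 2 a singleton is not a trivial block, so it is the
  side of an edge.\<close>

lemma flattening_rank_singleton:
  assumes n: "2 \<le> n" and t: "t \<in> HH d n r" and l: "l \<in> {1..n}"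
  shows "flattening_rank d {1..n} {l} t \<le> r"
proof -
  have eq: "block n id 0 (leaf_key n l) = {l}"
    using l by (auto simp: block_def leaf_key_eq_iff)
  moreover have "{l} \<noteq> {1..n}"
  proof
    assume "{l} = {1..n}"
    hence "card {l} = card {1..n}" by (rule arg_cong)
    thus False using n by simp
  qed
  ultimately show ?thesis
    using block_eq_side[OF n permutes_id, of 0 "leaf_key n l"] t
    unfolding HH_def HH_labelled_def TNS_def by force
qed

lemma HH_subset_TT:
  assumes k: "1 \<le> k" and n: "n \<le> threshold k"
  shows "HH d n r \<subseteq> TT d n (r ^ k)"
proof
  fix t assume t: "t \<in> HH d n r"
  let ?R = "\<lambda>S. flattening_rank d {1..n} S t"
  have tens: "t \<in> tensors d {1..n}" using t by (simp add: HH_def HH_labelled_def TNS_def)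
  show "t \<in> TT d n (r ^ k)"
  proof (cases "n < 2")
    case True
    thus ?thesis using tens by (simp add: TT_def TNS_def tt_edges_def)
  next
    case False
    hence n2: "2 \<le> n" by simp
    have compl: "?R ({1..n} - S) = ?R S" if "S \<subseteq> {1..n}" for S
      using that by (intro flattening_rank_complement) auto
    have rank_single: "?R {l} \<le> r ^ k" if "l \<in> {1..n}" for l
    proof -
      have "r ^ 1 \<le> r ^ k \<or> r = 0" using k power_increasing[of 1 k r] by (cases "r = 0") auto
      thus ?thesis using flattening_rank_singleton[OF n2 t that] by auto
    qed
    have rank_prefix: "?R {1..j} \<le> r ^ k" if j: "1 \<le> j" "j < n" for j
    proof (cases "r = 0")
      case False
      thus ?thesis using flattening_rank_prefix[OF k n2 n _ t j] by simp
    next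
      case True
      \<comment> \<open>Now r ^ k = 0, so the rank must vanish: splitting off leaf 1 yields a factor
        0.\<close>
      have "?R {1..j} = ?R ({1} \<union> {2..j})" using j by (intro arg_cong[where f = ?R]) auto
      also have "\<dots> \<le> ?R {1} * ?R {2..j}" using j by (intro flattening_rank_Un) auto
      also have "\<dots> = 0" using flattening_rank_singleton[OF n2 t, of 1] True n2 by simp
      finally show ?thesis by simp
    qed
    have "?R (leaves_on_side n (tt_edges n) Leaf e u) \<le> r ^ k" if "e \<in> tt_edges n" "u \<in> e" for e u
      using n2 that
    proof (cases rule: tt_side_cases)
      case (prefix j)
      thus ?thesis using prefix rank_prefix[of j] by simp
    next
      case (suffix j)
      thus ?thesis using suffix rank_prefix[of j] compl[of "{1..j}"] by simp
    next
      case (single l)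
      thus ?thesis using single rank_single[of l] by simp
    next
      case (cosingle l)
      thus ?thesis using cosingle rank_single[of l] compl[of "{l}"] by simp
    qed
    thus ?thesis using tens by (simp add: TT_def TNS_def)
  qed
qed

section \<open>Pairing leaves by edge-disjoint paths\<close>

definition separates :: "'a set \<Rightarrow> 'a \<times> 'a \<Rightarrow> bool" where
  "separates S m \<longleftrightarrow> (fst m \<in> S) \<noteq> (snd m \<in> S)"

text \<open>
  A set of pairs can be joined by edge-disjoint paths in the tree iff each edge separates at most
  one pair.
\<close>

definition edge_disjoint :: "nat \<Rightarrow> (nat \<Rightarrow> nat) \<Rightarrow> (nat \<times> nat) set \<Rightarrow> bool" where
  "edge_disjoint n \<pi> M \<longleftrightarrow> (\<forall>u b. \<forall>x\<in>M. \<forall>y\<in>M.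
     separates (block n \<pi> u b) x \<longrightarrow> separates (block n \<pi> u b) y \<longrightarrow> x = y)"

definition linked :: "nat \<Rightarrow> (nat \<Rightarrow> nat) \<Rightarrow> nat set \<Rightarrow> nat \<Rightarrow> nat \<Rightarrow> (nat \<times> nat) set \<Rightarrow> bool" where
  "linked n \<pi> B k j M \<longleftrightarrow> finite M \<and> card M = k \<and> M \<subseteq> (B \<inter> {..j}) \<times> (B \<inter> {j<..})
     \<and> edge_disjoint n \<pi> M"

lemma div_power_add: "(x::nat) div 2 ^ (u + v) = x div 2 ^ u div 2 ^ v"
  by (simp only: power_add div_mult2_eq)

text \<open>The quotient at a greater height is a function of the one at a smaller height, so the
  lower block lies inside or outside the higher one.\<close>

lemma blocks_laminar:
  "block n \<pi> u b \<inter> block n \<pi> u' b' = {} \<or> block n \<pi> u b \<subseteq> block n \<pi> u' b'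
    \<or> block n \<pi> u' b' \<subseteq> block n \<pi> u b"
proof -
  have *: "block n \<pi> u b \<inter> block n \<pi> (u + v) c = {} \<or> block n \<pi> u b \<subseteq> block n \<pi> (u + v) c"
    for u b v c
    unfolding block_def div_power_add by auto
  show ?thesis
  proof (cases "u \<le> u'")
    case True
    then obtain v where "u' = u + v" using le_Suc_ex by blast
    thus ?thesis using *[of u b v b'] by blast
  next
    case False
    then obtain v where "u = u' + v" using le_Suc_ex[of u' u] by auto
    thus ?thesis using *[of u' b' v b] by blast
  qed
qed

text \<open>The new pair takes its left end from \<open>M1\<close> and its right end from
  \<open>M3\<close>. A block that separates a pair of \<open>M2\<close> meets the middle block
  without containing it, so by laminarity it lies inside and contains neither new end.\<close>

lemma linked_merge:
  assumes L: "linked n \<pi> B1 k j1 M1" "linked n \<pi> (block n \<pi> u b) k j2 M2" "linked n \<pi> B3 k j3 M3"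
    and k: "1 \<le> k" and j: "j1 \<le> j2" "j2 \<le> j3"
    and disj: "B1 \<inter> block n \<pi> u b = {}" "B3 \<inter> block n \<pi> u b = {}"
    and sub: "B1 \<subseteq> B" "block n \<pi> u b \<subseteq> B" "B3 \<subseteq> B"
  shows "\<exists>j M. linked n \<pi> B (Suc k) j M"
proof -
  have "M1 \<noteq> {}" "M3 \<noteq> {}" using L(1,3) k by (auto simp: linked_def)
  then obtain p q' p' q where "(p, q') \<in> M1" "(p', q) \<in> M3" by (metis ex_in_conv surj_pair)
  hence p: "p \<in> B1" "p \<le> j2" and q: "q \<in> B3" "j2 < q"
    using L(1,3) j by (auto simp: linked_def)
  hence notin: "p \<notin> block n \<pi> u b" "q \<notin> block n \<pi> u b" using disj by auto
  have M2: "finite M2" "card M2 = k" "edge_disjoint n \<pi> M2"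
    "M2 \<subseteq> (block n \<pi> u b \<inter> {..j2}) \<times> (block n \<pi> u b \<inter> {j2<..})"
    using L(2) by (auto simp: linked_def)
  have new: "\<not> separates (block n \<pi> u' b') (p, q)"
    if "x \<in> M2" "separates (block n \<pi> u' b') x" for x u' b'
  proof -
    have "fst x \<in> block n \<pi> u b" "snd x \<in> block n \<pi> u b" using that(1) M2(4) by auto
    hence "block n \<pi> u' b' \<subseteq> block n \<pi> u b"
      using blocks_laminar[of n \<pi> u b u' b'] that(2) unfolding separates_def by blast
    thus ?thesis using notin by (auto simp: separates_def)
  qed
  have "edge_disjoint n \<pi> (insert (p, q) M2)"
    unfolding edge_disjoint_def using M2(3)[unfolded edge_disjoint_def] new by blast
  moreover have "(p, q) \<notin> M2" using M2(4) notin by auto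
  ultimately have "linked n \<pi> B (Suc k) j2 (insert (p, q) M2)"
    unfolding linked_def using M2 p q sub by auto
  thus ?thesis by blast
qed

text \<open>Height 2 * k + 2 always suffices; height 2 * k + 1 suffices if the bottom row extends
  far enough into the block, which for k = 0 says that the vertex has two children. The condition is
  inherited exactly by the second grandchild, as (3 * (4 * b + 1) + 1) * 4 ^ k = (3 * b + 1) * 4 ^
  (k + 1). The first grandchild needs less, and the right child is one level higher and so needs
  none.\<close>

lemma exists_linked:
  assumes n: "1 \<le> n" and \<pi>: "\<pi> permutes {1..n}"
    and "2 * k + 2 \<le> u \<or> u = 2 * k + 1 \<and> (3 * b + 1) * 4 ^ k + 2 \<le> 3 * excess n"
    and "(b + 1) * 2 ^ u \<le> 2 ^ (full_depth n + 1)"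
  shows "\<exists>j M. linked n \<pi> (block n \<pi> u b) (Suc k) j M"
  using assms(3,4)
proof (induction k arbitrary: u b)
  case 0
  have label: "\<exists>l\<in>{1..n}. leaf_key n (\<pi> l) = x"
    if x: "even x \<and> x < 2 ^ (full_depth n + 1) \<or> x < 2 * excess n" for x
  proof -
    obtain l' where l': "l' \<in> {1..n}" "leaf_key n l' = x"
      using leaf_key_surj[OF n x] by auto
    then obtain l where "l \<in> {1..n}" "\<pi> l = l'" using permutes_image[OF \<pi>] by (metis imageE)
    thus ?thesis using l' by blast
  qed
  obtain x y where xy: "x \<noteq> y" "x div 2 ^ u = b" "y div 2 ^ u = b"
    "even x \<and> x < 2 ^ (full_depth n + 1) \<or> x < 2 * excess n"
    "even y \<and> y < 2 ^ (full_depth n + 1) \<or> y < 2 * excess n"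
  proof (cases "2 \<le> u")
    case True
    then obtain v where v: "u = 2 + v" using le_Suc_ex by blast
    \<comment> \<open>Even keys occur whether or not the bottom row is filled there, so two of them
      serve as \<open>x\<close> and \<open>y\<close>.\<close>
    have P: "4 \<le> (2::nat) ^ u" "even ((2::nat) ^ u)" using v by (auto simp: power_add)
    have "b * 2 ^ u + 2 < 2 ^ (full_depth n + 1)" using 0(2) P(1) by simp
    moreover have "(b * 2 ^ u + 2) div 2 ^ u = b" using P(1) by (intro div_nat_eqI) auto
    ultimately show thesis
      using P by (intro that[of "b * 2 ^ u" "b * 2 ^ u + 2"]) (simp_all del: power_Suc add_2_eq_Suc')
  next
    case False
    thus thesis using 0 by (intro that[of "2 * b" "2 * b + 1"]) auto
  qed
  from label[OF xy(4)] obtain l where l: "l \<in> {1..n}" "leaf_key n (\<pi> l) = x" ..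
  from label[OF xy(5)] obtain l' where l': "l' \<in> {1..n}" "leaf_key n (\<pi> l') = y" ..
  have "l \<noteq> l'" using l l' xy(1) by auto
  hence "linked n \<pi> (block n \<pi> u b) 1 (min l l') {(min l l', max l l')}"
    using l l' xy by (auto simp: linked_def edge_disjoint_def block_def min_def max_def)
  thus ?case by auto
next
  case (Suc k)
  have "2 \<le> u" using Suc.prems(1) by auto
  then obtain v where "u = 2 + v" using le_Suc_ex by blast
  hence u: "u = Suc (Suc v)" by simp
  define B1 where "B1 = block n \<pi> v (4 * b)"
  define B2 where "B2 = block n \<pi> v (4 * b + 1)"
  define B3 where "B3 = block n \<pi> (Suc v) (2 * b + 1)"
  define B where "B = block n \<pi> u b"
  have le: "(b + 1) * 2 ^ u \<le> 2 ^ (full_depth n + 1)" by fact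
  have pw: "(2::nat) ^ u = 4 * 2 ^ v" "(2::nat) ^ Suc v = 2 * 2 ^ v" by (simp_all add: u)
  have range: "(4 * b + 1) * 2 ^ v \<le> 2 ^ (full_depth n + 1)"
    "(4 * b + 1 + 1) * 2 ^ v \<le> 2 ^ (full_depth n + 1)"
    "(2 * b + 1 + 1) * 2 ^ Suc v \<le> 2 ^ (full_depth n + 1)"
    using le unfolding pw by (auto simp: algebra_simps simp del: power_Suc)
  have c: "2 * k + 2 \<le> v \<or> v = 2 * k + 1 \<and> (3 * (4 * b) + 1) * 4 ^ k + 2 \<le> 3 * excess n"
    "2 * k + 2 \<le> v \<or> v = 2 * k + 1 \<and> (3 * (4 * b + 1) + 1) * 4 ^ k + 2 \<le> 3 * excess n"
    "2 * k + 2 \<le> Suc v"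
    using Suc.prems(1) u by (auto simp: algebra_simps)
  obtain j1 M1 where L1: "linked n \<pi> B1 (Suc k) j1 M1"
    using Suc.IH[OF c(1) range(1)] unfolding B1_def by blast
  obtain j2 M2 where L2: "linked n \<pi> B2 (Suc k) j2 M2"
    using Suc.IH[OF c(2) range(2)] unfolding B2_def by blast
  obtain j3 M3 where L3: "linked n \<pi> B3 (Suc k) j3 M3"
    using Suc.IH[OF disjI1[OF c(3)] range(3)] unfolding B3_def by blast
  have sub: "B1 \<subseteq> B" "B2 \<subseteq> B" "B3 \<subseteq> B"
    unfolding B1_def B2_def B3_def B_def u block_def div_power_Suc by auto
  have disj: "B1 \<inter> B2 = {}" "B2 \<inter> B1 = {}" "B1 \<inter> B3 = {}" "B3 \<inter> B1 = {}" "B2 \<inter> B3 = {}" "B3 \<inter> B2 = {}"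
    unfolding B1_def B2_def B3_def block_def div_power_Suc by auto
  note merge1 = linked_merge[of n \<pi> _ "Suc k" _ _ v "4 * b", folded B1_def]
    and merge2 = linked_merge[of n \<pi> _ "Suc k" _ _ v "4 * b + 1", folded B2_def]
    and merge3 = linked_merge[of n \<pi> _ "Suc k" _ _ "Suc v" "2 * b + 1", folded B3_def]
  have k: "1 \<le> Suc k" by simp
  \<comment> \<open>Whichever block has the median cut position becomes the middle one; all three
    are blocks, so each qualifies.\<close>
  consider "j1 \<le> j2" "j2 \<le> j3" | "j3 \<le> j2" "j2 \<le> j1" | "j2 \<le> j1" "j1 \<le> j3" | "j3 \<le> j1" "j1 \<le> j2"
    | "j1 \<le> j3" "j3 \<le> j2" | "j2 \<le> j3" "j3 \<le> j1" by linarith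
  hence "\<exists>j M. linked n \<pi> B (Suc (Suc k)) j M"
  proof cases
    case 1 thus ?thesis by (rule merge2[OF L1 L2 L3 k _ _ disj(1,6) sub])
  next
    case 2 thus ?thesis by (rule merge2[OF L3 L2 L1 k _ _ disj(6,1) sub(3,2,1)])
  next
    case 3 thus ?thesis by (rule merge1[OF L2 L1 L3 k _ _ disj(2,4) sub(2,1,3)])
  next
    case 4 thus ?thesis by (rule merge1[OF L3 L1 L2 k _ _ disj(4,2) sub(3,1,2)])
  next
    case 5 thus ?thesis by (rule merge3[OF L1 L3 L2 k _ _ disj(3,5) sub(1,3,2)])
  next
    case 6 thus ?thesis by (rule merge3[OF L2 L3 L1 k _ _ disj(5,3) sub(2,3,1)])
  qed
  thus ?case unfolding B_def .
qed

text \<open>The singleton \<open>{l}\<close> is itself a block, and it separates every pair with end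
  \<open>l\<close>.\<close>

lemma edge_disjoint_pairs:
  assumes \<pi>: "\<pi> permutes {1..n}" and M: "edge_disjoint n \<pi> M" "M \<subseteq> {1..j} \<times> {j<..n}"
    and x: "x \<in> M" "y \<in> M" "l = fst x \<or> l = snd x" "l = fst y \<or> l = snd y"
  shows "x = y"
proof -
  have l: "l \<in> {1..n}" using M(2) x by force
  have "leaf_key n (\<pi> l') = leaf_key n (\<pi> l) \<longleftrightarrow> l' = l" if "l' \<in> {1..n}" for l'
  proof -
    have "\<pi> l \<in> {1..n}" "\<pi> l' \<in> {1..n}" using l that \<pi> by (simp_all only: permutes_in_image)
    thus ?thesis using inj_eq[OF permutes_inj[OF \<pi>]] by (simp only: leaf_key_eq_iff)
  qed
  hence "block n \<pi> 0 (leaf_key n (\<pi> l)) = {l}" using l by (auto simp: block_def)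
  moreover have "separates {l} m" if "m \<in> M" "l = fst m \<or> l = snd m" for m
  proof -
    have "m \<in> {1..j} \<times> {j<..n}" using M(2) that(1) by blast
    hence "fst m \<noteq> snd m" by (cases m) auto
    thus ?thesis using that(2) unfolding separates_def by auto
  qed
  ultimately show ?thesis using M(1) x unfolding edge_disjoint_def by metis
qed


section \<open>Products of Bell pairs\<close>

text \<open>
  The restriction to \<open>S\<close> of a basis vector that occurs in the product of the Bell pairs
  \<open>\<Sum>i<r. e\<^sub>i \<otimes> e\<^sub>i\<close>, one for each pair in \<open>M\<close>, and of copies of \<open>e\<^sub>0\<close>; a pair separated by
  \<open>S\<close> is in state \<open>i\<close>.
\<close>

definition bell_support :: "nat \<Rightarrow> (nat \<times> nat) set \<Rightarrow> nat set \<Rightarrow> nat \<Rightarrow> (nat \<Rightarrow> nat) \<Rightarrow> bool" where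
  "bell_support r M S i y \<longleftrightarrow>
     (\<forall>p q. (p, q) \<in> M \<longrightarrow> (p \<in> S \<longrightarrow> q \<in> S \<longrightarrow> y p = y q \<and> y p < r) \<and>
        (p \<in> S \<longrightarrow> q \<notin> S \<longrightarrow> y p = i) \<and> (p \<notin> S \<longrightarrow> q \<in> S \<longrightarrow> y q = i)) \<and>
     (\<forall>l\<in>S. l \<notin> fst ` M \<union> snd ` M \<longrightarrow> y l = 0)"

definition bell_tensor :: "(nat \<Rightarrow> nat) \<Rightarrow> nat \<Rightarrow> nat \<Rightarrow> (nat \<times> nat) set \<Rightarrow> tensor" where
  "bell_tensor d n r M x =
     of_bool (x \<in> multi_indices d {1..n} \<and> bell_support r M {1..n} 0 x)"

lemma bell_support_restrict: "bell_support r M S i (restrict x S) \<longleftrightarrow> bell_support r M S i x"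
  unfolding bell_support_def by (simp cong: imp_cong)

lemma bell_support_all:
  assumes "M \<subseteq> A \<times> A"
  shows "bell_support r M A i x \<longleftrightarrow> (\<forall>p q. (p, q) \<in> M \<longrightarrow> x p = x q \<and> x p < r) \<and>
    (\<forall>l\<in>A. l \<notin> fst ` M \<union> snd ` M \<longrightarrow> x l = 0)"
  using assms unfolding bell_support_def by blast

text \<open>If \<open>S\<close> separates a pair, then fixing its state \<open>i\<close> decouples
  \<open>S\<close> from its complement, which gives \<open>r\<close> product terms. If it separates
  none, the tensor is a single product.\<close>

lemma flattening_rank_bell_le:
  assumes S: "S \<subseteq> {1..n}" and M: "M \<subseteq> {1..n} \<times> {1..n}" and r: "1 \<le> r"
    and one: "\<And>x y. x \<in> M \<Longrightarrow> y \<in> M \<Longrightarrow> separates S x \<Longrightarrow> separates S y \<Longrightarrow> x = y"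
  shows "flattening_rank d {1..n} S (bell_tensor d n r M) \<le> r"
proof -
  let ?A = "{1..n}"
  have rank: "flattening_rank d ?A S (bell_tensor d n r M) \<le> card I"
    if I: "finite I" and split: "\<And>x. x \<in> multi_indices d ?A \<Longrightarrow>
        (of_bool (bell_support r M ?A 0 x) :: complex) =
        (\<Sum>i\<in>I. of_bool (bell_support r M S i x \<and> bell_support r M (?A - S) i x))" for I
  proof (rule flattening_rank_le_card[OF I S, of _ _ "\<lambda>i y. of_bool (bell_support r M S i y)"
          "\<lambda>i y. of_bool (bell_support r M (?A - S) i y)"])
    fix x assume x: "x \<in> multi_indices d ?A"
    hence "bell_tensor d n r M x = of_bool (bell_support r M ?A 0 x)"
      by (simp add: bell_tensor_def)
    thus "bell_tensor d n r M x = (\<Sum>i\<in>I. of_bool (bell_support r M S i (restrict x S)) *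
        of_bool (bell_support r M (?A - S) i (restrict x (?A - S))))"
      by (simp only: split[OF x] bell_support_restrict of_bool_conj)
  qed
  show ?thesis
  proof (cases "\<exists>x\<in>M. separates S x")
    case True
    then obtain p0 q0 where pq: "(p0, q0) \<in> M" "separates S (p0, q0)" by auto
    have iff: "bell_support r M S i x \<and> bell_support r M (?A - S) i x \<longleftrightarrow>
      bell_support r M ?A 0 x \<and> i = x p0" if i: "i < r" for i x
    proof -
      have sep: "p = p0 \<and> q = q0" if "(p, q) \<in> M" "(p \<in> S) \<noteq> (q \<in> S)" for p q
        using one[OF that(1) pq(1)] pq(2) that(2) by (simp add: separates_def)
      have MA: "p \<in> ?A \<and> q \<in> ?A" if "(p, q) \<in> M" for p q using that M by blast
      show ?thesis
      proof
        assume L: "bell_support r M S i x \<and> bell_support r M (?A - S) i x"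
        have "x p = x q \<and> x p < r \<and> (((p \<in> S) \<noteq> (q \<in> S)) \<longrightarrow> i = x p)" if "(p, q) \<in> M" for p q
          using L that MA[OF that] i unfolding bell_support_def by (cases "p \<in> S"; cases "q \<in> S") force+
        moreover have "x l = 0" if "l \<in> ?A" "l \<notin> fst ` M \<union> snd ` M" for l
          using L that unfolding bell_support_def by (cases "l \<in> S") blast+
        moreover have "(p0 \<in> S) \<noteq> (q0 \<in> S)" using pq(2) by (simp add: separates_def)
        ultimately show "bell_support r M ?A 0 x \<and> i = x p0"
          using pq(1) unfolding bell_support_all[OF M] by blast
      next
        assume R: "bell_support r M ?A 0 x \<and> i = x p0"
        hence eq: "x p = x q \<and> x p < r" if "(p, q) \<in> M" for p q
          using that unfolding bell_support_all[OF M] by blast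
        have zero: "x l = 0" if "l \<in> ?A" "l \<notin> fst ` M \<union> snd ` M" for l
          using R that unfolding bell_support_all[OF M] by blast
        have state: "x p = i \<and> x q = i" if "(p, q) \<in> M" "(p \<in> S) \<noteq> (q \<in> S)" for p q
          using sep[OF that] eq[OF that(1)] R by simp
        show "bell_support r M S i x \<and> bell_support r M (?A - S) i x"
          unfolding bell_support_def using eq zero state MA S by blast
      qed
    qed
    have "flattening_rank d ?A S (bell_tensor d n r M) \<le> card {..<r}"
    proof (rule rank)
      fix x
      \<comment> \<open>For a point of the support, the only contributing index \<open>x p0\<close>
        lies in the range of summation.\<close>
      have "x p0 < r" if "bell_support r M ?A 0 x"
        using that pq(1) M unfolding bell_support_def by blast
      hence "(\<Sum>i<r. of_bool (bell_support r M ?A 0 x \<and> i = x p0) :: complex)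
        = of_bool (bell_support r M ?A 0 x)"
        by (cases "bell_support r M ?A 0 x") (simp_all add: of_bool_def)
      moreover have "(\<Sum>i<r. of_bool (bell_support r M S i x \<and> bell_support r M (?A - S) i x))
        = (\<Sum>i<r. of_bool (bell_support r M ?A 0 x \<and> i = x p0) :: complex)"
        by (intro sum.cong refl arg_cong[where f = of_bool] iff) simp
      ultimately show "(of_bool (bell_support r M ?A 0 x) :: complex) =
        (\<Sum>i<r. of_bool (bell_support r M S i x \<and> bell_support r M (?A - S) i x))"
        by (simp only:)
    qed simp
    thus ?thesis by simp
  next
    case False
    have "bell_support r M S 0 x \<and> bell_support r M (?A - S) 0 x \<longleftrightarrow> bell_support r M ?A 0 x" for x
    proof -
      have MA: "p \<in> ?A \<and> q \<in> ?A \<and> (p \<in> S \<longleftrightarrow> q \<in> S)" if "(p, q) \<in> M" for p q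
        using that M False unfolding separates_def by force
      show ?thesis
      proof
        assume L: "bell_support r M S 0 x \<and> bell_support r M (?A - S) 0 x"
        have "x p = x q \<and> x p < r" if "(p, q) \<in> M" for p q
          using L that MA[OF that] unfolding bell_support_def by (cases "p \<in> S") blast+
        moreover have "x l = 0" if "l \<in> ?A" "l \<notin> fst ` M \<union> snd ` M" for l
          using L that unfolding bell_support_def by (cases "l \<in> S") blast+
        ultimately show "bell_support r M ?A 0 x" unfolding bell_support_all[OF M] by blast
      next
        assume R: "bell_support r M ?A 0 x"
        have "x p = x q \<and> x p < r" if "(p, q) \<in> M" for p q
          using R that MA[OF that] unfolding bell_support_def by blast
        moreover have "x l = 0" if "l \<in> ?A" "l \<notin> fst ` M \<union> snd ` M" for l
          using R that unfolding bell_support_def by blast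
        ultimately show "bell_support r M S 0 x \<and> bell_support r M (?A - S) 0 x"
          unfolding bell_support_def using S MA by blast
      qed
    qed
    hence "flattening_rank d ?A S (bell_tensor d n r M) \<le> card {0::nat}"
      by (intro rank) simp_all
    thus ?thesis using r by simp
  qed
qed

text \<open>Each assignment \<open>c\<close> of states to the pairs gives a left half
  \<open>X c\<close> and a right half \<open>Y c\<close>. Halves of two assignments form a support
  point only if the assignments agree, so they index an identity submatrix of size r ^
  \<open>card M\<close>.\<close>

lemma flattening_rank_bell_ge:
  assumes j: "j \<le> n" and M: "finite M" "M \<subseteq> {1..j} \<times> {j<..n}"
    and disj: "\<And>x y l. x \<in> M \<Longrightarrow> y \<in> M \<Longrightarrow> l = fst x \<or> l = snd x \<Longrightarrow> l = fst y \<or> l = snd y \<Longrightarrow> x = y"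
    and r: "1 \<le> r" and d: "\<And>l. l \<in> {1..n} \<Longrightarrow> r \<le> d l"
  shows "r ^ card M \<le> flattening_rank d {1..n} {1..j} (bell_tensor d n r M)"
proof -
  \<comment> \<open>By disjointness the chosen pair is the only one with end \<open>l\<close>;
    unpaired leaves get 0, as \<open>bell_support\<close> demands.\<close>
  define val where "val c l = (if l \<in> fst ` M \<union> snd ` M
    then c (SOME m. m \<in> M \<and> (l = fst m \<or> l = snd m)) else (0::nat))" for c and l :: nat
  have val: "val c l = c m" if "m \<in> M" "l = fst m \<or> l = snd m" for c m l
  proof -
    have "(SOME m. m \<in> M \<and> (l = fst m \<or> l = snd m)) = m"
      using that disj by (intro some_equality) blast+
    thus ?thesis using that by (auto simp: val_def)
  qed
  let ?I = "M \<rightarrow>\<^sub>E {..<r}"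
  define X where "X c = restrict (val c) {1..j}" for c
  define Y where "Y c = restrict (val c) ({1..n} - {1..j})" for c
  have val_less: "val c l < d l" if "c \<in> ?I" "l \<in> {1..n}" for c l
  proof -
    have "val c l < r"
    proof (cases "l \<in> fst ` M \<union> snd ` M")
      case True
      then obtain m where m: "m \<in> M" "l = fst m \<or> l = snd m" by blast
      thus ?thesis using val[OF m, of c] that(1) by (auto simp: PiE_iff)
    next
      case False
      thus ?thesis using r by (simp add: val_def)
    qed
    thus ?thesis using d[OF that(2)] by linarith
  qed
  have X: "X c \<in> multi_indices d {1..j}" and Y: "Y c \<in> multi_indices d ({1..n} - {1..j})"
    if "c \<in> ?I" for c
    using val_less[OF that] j by (auto simp: X_def Y_def multi_indices_def)
  have "card ?I \<le> flattening_rank d {1..n} {1..j} (bell_tensor d n r M)"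
  proof (rule card_le_flattening_rank[OF _ _ X Y])
    fix c c' assume c: "c \<in> ?I" "c' \<in> ?I"
    let ?x = "override_on (Y c') (X c) {1..j}"
    have x: "?x l = (if l \<le> j then val c l else val c' l)" if "l \<in> {1..n}" for l
      using that by (auto simp: X_def Y_def)
    have x_mi: "?x \<in> multi_indices d {1..n}"
      using X[OF c(1)] Y[OF c(2)] j by (intro override_on_multi_indices) auto
    have "bell_support r M {1..n} 0 ?x \<longleftrightarrow> (\<forall>m\<in>M. c m = c' m)"
    proof -
      have pq: "?x p = c (p, q) \<and> ?x q = c' (p, q) \<and> c (p, q) < r \<and> p \<in> {1..n} \<and> q \<in> {1..n}"
        if "(p, q) \<in> M" for p q
      proof -
        have "p \<in> {1..n}" "q \<in> {1..n}" "p \<le> j" "\<not> q \<le> j" using that M(2) j by auto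
        thus ?thesis
          using val[OF that, of p c] val[OF that, of q c'] x[of p] x[of q] c(1) that by auto
      qed
      have zero: "?x l = 0" if "l \<in> {1..n}" "l \<notin> fst ` M \<union> snd ` M" for l
        using x[OF that(1)] that(2) by (simp add: val_def)
      show ?thesis
      proof
        assume L: "bell_support r M {1..n} 0 ?x"
        have "c (p, q) = c' (p, q)" if "(p, q) \<in> M" for p q
        proof -
          have "?x p = ?x q" using L pq[OF that] that unfolding bell_support_def by blast
          thus ?thesis using pq[OF that] by (simp only:)
        qed
        thus "\<forall>m\<in>M. c m = c' m" by auto
      next
        assume R: "\<forall>m\<in>M. c m = c' m"
        have "?x p = ?x q \<and> ?x p < r" if "(p, q) \<in> M" for p q
          using R pq[OF that] that by (simp only:)
        thus "bell_support r M {1..n} 0 ?x"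
          unfolding bell_support_def using pq zero by blast
      qed
    qed
    also have "\<dots> \<longleftrightarrow> c = c'"
      using c by (auto intro: PiE_ext)
    finally show "bell_tensor d n r M ?x = (if c = c' then 1 else 0)"
      using x_mi by (simp add: bell_tensor_def)
  qed (use M in \<open>auto intro!: finite_PiE\<close>)
  thus ?thesis using M(1) by (simp add: card_PiE)
qed

section \<open>The non-inclusion for every labelling\<close>

lemma HH_labelled_not_subset_TT:
  assumes n: "2 \<le> n" "threshold k < n" and r: "1 \<le> r" and d: "\<And>l. l \<in> {1..n} \<Longrightarrow> r \<le> d l"
    and \<pi>: "\<pi> permutes {1..n}"
  shows "\<not> HH_labelled d n \<pi> r \<subseteq> TT d n (r ^ Suc k - 1)"
proof -
  let ?h = "full_depth n"
  have hm: "n = 2 ^ ?h + excess n" "excess n < 2 ^ ?h"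
    using n(1) n_eq_full_depth_excess[of n] by auto
  \<comment> \<open>This is the condition of \<open>exists_linked\<close> for the whole tree, the
    block at height \<open>?h + 1\<close> and position 0. The case k = 0 is separate since the
    closed form of the threshold fails there.\<close>
  have "2 * k + 2 \<le> ?h + 1 \<or> ?h + 1 = 2 * k + 1 \<and> (3 * 0 + 1) * 4 ^ k + 2 \<le> 3 * excess n"
  proof (cases "k = 0")
    case True
    thus ?thesis using full_depth_pos[OF n(1)] by simp
  next
    case False
    hence n3: "4 * 4 ^ k + 2 \<le> 3 * n" using threshold_eq[of k] n(2) by simp
    have pow: "(2::nat) ^ (2 * k) = 4 ^ k" by (simp add: power_mult)
    have "2 * k \<le> ?h"
    proof (rule ccontr)
      assume "\<not> 2 * k \<le> ?h"
      hence "(2::nat) ^ (?h + 1) \<le> 2 ^ (2 * k)" by (intro power_increasing) auto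
      thus False using hm n3 pow by simp
    qed
    moreover have "4 ^ k + 2 \<le> 3 * excess n" if "?h = 2 * k"
      using hm(1) n3 pow unfolding that by linarith
    ultimately show ?thesis by (cases "?h = 2 * k") auto
  qed
  then obtain j M where "linked n \<pi> (block n \<pi> (?h + 1) 0) (Suc k) j M"
    using exists_linked[OF _ \<pi>, of k "?h + 1" 0] n(1) by auto
  hence M: "finite M" "card M = Suc k" "M \<subseteq> {1..j} \<times> {j<..n}" "edge_disjoint n \<pi> M"
    by (auto simp: linked_def block_def)
  have "M \<noteq> {}" using M(2) by auto
  hence j: "1 \<le> j" "j < n" using M(3) by auto
  have MA: "M \<subseteq> {1..n} \<times> {1..n}" using M(3) j by fastforce
  define t where "t = bell_tensor d n r M"
  have block: "flattening_rank d {1..n} (block n \<pi> u b) t \<le> r" for u b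
    unfolding t_def using M(4)
    by (intro flattening_rank_bell_le MA r) (auto simp: block_def edge_disjoint_def)
  have "t \<in> HH_labelled d n \<pi> r"
    unfolding HH_labelled_def TNS_def
  proof (intro CollectI conjI ballI)
    show "t \<in> tensors d {1..n}" by (simp add: t_def bell_tensor_def tensors_def)
    fix e v assume "e \<in> apb_edges n" "v \<in> e"
    from HH_side_cases[OF n(1) \<pi> this] obtain u b where
      "leaves_on_side n (apb_edges n) (\<lambda>l. natural_leaf n (\<pi> l)) e v \<in> {block n \<pi> u b, {1..n} - block n \<pi> u b}"
      by blast
    moreover have "flattening_rank d {1..n} ({1..n} - block n \<pi> u b) t \<le> r"
      using block[of u b] by (subst flattening_rank_complement) (auto simp: block_def)
    ultimately show "flattening_rank d {1..n}
        (leaves_on_side n (apb_edges n) (\<lambda>l. natural_leaf n (\<pi> l)) e v) t \<le> r"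
      using block[of u b] by auto
  qed
  moreover have "t \<notin> TT d n (r ^ Suc k - 1)"
  proof
    assume "t \<in> TT d n (r ^ Suc k - 1)"
    moreover obtain e u where "e \<in> tt_edges n" "u \<in> e"
      "leaves_on_side n (tt_edges n) Leaf e u = {1..j}"
      by (rule tt_prefix_side[OF j])
    ultimately have "flattening_rank d {1..n} {1..j} t \<le> r ^ Suc k - 1"
      unfolding TT_def TNS_def by force
    moreover have "r ^ Suc k \<le> flattening_rank d {1..n} {1..j} t"
      unfolding t_def M(2)[symmetric] using edge_disjoint_pairs[OF \<pi> M(4,3)] j
      by (intro flattening_rank_bell_ge M(1,3) r d) auto
    \<comment> \<open>Positivity makes the truncated subtraction a true one.\<close>
    moreover have "0 < r ^ Suc k" using r by simp
    ultimately show False by linarith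
  qed
  ultimately show ?thesis by blast
qed

text \<open>The second half needs its extra hypotheses. For n = 1 neither tree has an edge, for r =
  0 the truncated r ^ k - 1 equals r ^ k, and the Bell pairs need factors of dimension at least
  \<open>r\<close>.\<close>

theorem mainTheorem5:
  fixes d :: "nat \<Rightarrow> nat" and k n r :: nat
  assumes "k \<ge> 1" and "n \<in> {threshold (k - 1) + 1..threshold k}"
  shows "HH d n r \<subseteq> TT d n (r ^ k) \<and>
    (n \<ge> 2 \<and> r \<ge> 1 \<and> (\<forall>l\<in>{1..n}. d l \<ge> r) \<longrightarrow>
      (\<forall>\<pi>. \<pi> permutes {1..n} \<longrightarrow> \<not> HH_labelled d n \<pi> r \<subseteq> TT d n (r ^ k - 1)))"
proof (intro conjI impI allI)
  show "HH d n r \<subseteq> TT d n (r ^ k)"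
    using assms by (intro HH_subset_TT) auto
next
  fix \<pi> assume *: "n \<ge> 2 \<and> r \<ge> 1 \<and> (\<forall>l\<in>{1..n}. d l \<ge> r)" and \<pi>: "\<pi> permutes {1..n}"
  have "threshold (k - 1) < n" using assms(2) by simp
  from HH_labelled_not_subset_TT[OF _ this _ _ \<pi>, of r d] *
  show "\<not> HH_labelled d n \<pi> r \<subseteq> TT d n (r ^ k - 1)" using assms(1) by simp
qed

end
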